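(* Let $G$ be a Carnot group with first layer $\mathfrak{g}_1$ and Haar measure $\mu$. Assume that for any $X\in\mathfrak{g}_1\setminus\{0\}$ there is an integer $p\ge2$ such that the map $\Gamma_p:(\mathfrak{g}_1)^p\to G$ defined by $\Gamma_p(X_1,\dots,X_p)=\exp X_1\cdots\exp X_p$ is open at $(X,\dots,X)\in(\mathfrak{g}_1)^p$. Then for any monotone subset $E$ of $G$ both $\operatorname{Int}_\mu(E)$ and $\operatorname{spt}_\mu(E)$ are precisely monotone.
   Context: A Carnot group $G$ is a connected, simply connected Lie group whose Lie algebra $\mathfrak{g}$ of left-invariant vector fields is equipped with a stratification $\mathfrak{g}=\mathfrak{g}_1\oplus\cdots\oplus\mathfrak{g}_s$, i.e. $[\mathfrak{g}_1,\mathfrak{g}_i]=\mathfrak{g}_{i+1}$ for $i=1,\dots,s$, $\mathfrak{g}_s\neq\{0\}$ and $\mathfrak{g}_i=\{0\}$ for $i>s$ (where $[\mathfrak{g}_1,\mathfrak{g}_i]$ is the linear span of brackets). The exponential map $\exp:\mathfrak{g}\to G$ is a smooth diffeomorphism. $\mu$ is a Haar measure on $G$. A map is open at a point $a$ if it maps every neighborhood of $a$ onto a neighborhood of the image of $a$. Lines. A line in $G$ is the unparameterized oriented image of an integral curve of some $X\in\mathfrak{g}_1\setminus\{0\}$, i.e. a set $\{x\cdot\exp(tX): t\in\mathbb{R}\}$ with the orientation given by $X$. Fix a scalar product on $\mathfrak{g}_1$ with unit sphere $\mathbb{S}(\mathfrak{g}_1)$. For $X\in\mathbb{S}(\mathfrak{g}_1)$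 let $N_X=\exp(X^\perp)$, where $X^\perp$ is the direct sum of the orthogonal complement of $\mathbb{R}X$ in $\mathfrak{g}_1$ with $\oplus_{i=2}^s\mathfrak{g}_i$; $N_X$ is a subgroup of $G$. Every line can be written uniquely as $\{x\cdot\exp(tX):t\in\mathbb{R}\}$, oriented by $X$, with $X\in\mathbb{S}(\mathfrak{g}_1)$ and $x\in N_X$, so the set of lines is identified with the smooth manifold $\bigsqcup_{X\in\mathbb{S}(\mathfrak{g}_1)}\{X\}\times N_X$. A set of lines is null if it has measure zero for some (equivalently any) smooth measure with positive density on this manifold; one such measure is $A\mapsto\int_{\mathbb{S}(\mathfrak{g}_1)}\mu_X(\{x\in N_X:(X,x)\in A\})\,d\sigma(X)$ for Borel $A$ (extended to all sets as an outer measure), where $\sigma$ is the standard measure on the sphere and $\mu_X$ is the Haar measure on $N_X$ normalized so that $(x,t)\mapsto x\cdot\exp(tX)$ is measure preserving from $(N_X\times\mathbb{R},\mu_X\otimes dt)$ to $(G,\mu)$. The notion of null set of lines does not depend on the scalar product. Monotone sets. A line $L$ is monotone for $E\subset G$ if for some (equivalently any) parameterization $t\in\mathbb{R}\mapsto x\cdot\exp(tX)$ of $L$, with $X\in\mathfrak{g}_1\setminus\{0\}$ and $x\in G$ such that $L=\{x\cdot\exp(tX):t\in\mathbb{R}\}$ oriented by $X$, the function $t\mapsto \mathbf{1}_E(x\cdot\exp(tX))$ agrees almost everywhere (for Lebesgue measure on $\mathbb{R}$) with a monotone function. A set $E\subset G$ is monotone if it is $\mu$-measurable and almost every line in $G$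 is monotone for $E$. A set $E\subset G$ is precisely monotone if for every line $L$ both $E\cap L$ and $L\setminus E$ are connected (the empty set being connected). Measure-theoretic notions. $E^c=G\setminus E$. For $\mu$-measurable $E$: $\operatorname{spt}_\mu(E)$ is the support of the restriction of $\mu$ to $E$ (i.e. the set of $x$ such that $\mu(E\cap U)>0$ for every open neighborhood $U$ of $x$), and $\operatorname{Int}_\mu(E)=G\setminus\operatorname{spt}_\mu(E^c)$. *)

theory Defs
  imports "HOL-Analysis.Analysis" "HOL-Algebra.Group" "HOL-Library.Function_Algebras"
begin

section \<open>Smooth manifolds and smooth maps\<close>

text \<open>Functions with values in a real vector space are added and scaled pointwise.\<close>

instantiation "fun" :: (type, real_vector) real_vector
begin

definition scaleR_fun :: "real \<Rightarrow> ('a \<Rightarrow> 'b) \<Rightarrow> 'a \<Rightarrow> 'b"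
  where "scaleR_fun c f = (\<lambda>x. c *\<^sub>R f x)"

instance
  by standard (simp_all add: fun_eq_iff scaleR_fun_def scaleR_add_right scaleR_add_left)

end

text \<open>Continuous differentiability of order \<open>k\<close> and smoothness, on open subsets of Euclidean
  spaces: a map is of class \<open>C\<^sup>k\<^sup>+\<^sup>1\<close> if it is differentiable with directional derivatives of
  class \<open>C\<^sup>k\<close>.\<close>

primrec Ck_on ::
  "nat \<Rightarrow> 'a::euclidean_space set \<Rightarrow> ('a \<Rightarrow> 'b::euclidean_space) \<Rightarrow> bool" where
  "Ck_on 0 S f \<longleftrightarrow> continuous_on S f"
| "Ck_on (Suc k) S f \<longleftrightarrow>
     (\<forall>x\<in>S. f differentiable at x) \<and> (\<forall>v. Ck_on k S (\<lambda>x. frechet_derivative f (at x) v))"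

definition smooth_on :: "'a::euclidean_space set \<Rightarrow> ('a \<Rightarrow> 'b::euclidean_space) \<Rightarrow> bool" where
  "smooth_on S f \<longleftrightarrow> open S \<and> (\<forall>k. Ck_on k S f)"

text \<open>A chart is given by its domain and its coordinate map, whose values outside the domain
  are irrelevant. An atlas need not be maximal.\<close>

type_synonym ('g, 'e) chart = "'g set \<times> ('g \<Rightarrow> 'e)"

definition is_chart :: "('g::topological_space, 'e::euclidean_space) chart \<Rightarrow> bool" where
  "is_chart c \<longleftrightarrow> open (fst c) \<and> open (snd c ` fst c) \<and>
     homeomorphism (fst c) (snd c ` fst c) (snd c) (inv_into (fst c) (snd c))"

abbreviation coords_inv :: "('g, 'e) chart \<Rightarrow> 'e \<Rightarrow> 'g" where
  "coords_inv c \<equiv> inv_into (fst c) (snd c)"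

definition smooth_atlas :: "('g::topological_space, 'e::euclidean_space) chart set \<Rightarrow> bool" where
  "smooth_atlas A \<longleftrightarrow> (\<forall>c\<in>A. is_chart c) \<and> (\<Union>c\<in>A. fst c) = UNIV \<and>
     (\<forall>c\<in>A. \<forall>d\<in>A. smooth_on (snd c ` (fst c \<inter> fst d)) (snd d \<circ> coords_inv c))"

definition smooth_map ::
  "('g::topological_space, 'e::euclidean_space) chart set \<Rightarrow>
   ('h::topological_space, 'f::euclidean_space) chart set \<Rightarrow> ('g \<Rightarrow> 'h) \<Rightarrow> bool" where
  "smooth_map A B F \<longleftrightarrow> continuous_on UNIV F \<and>
     (\<forall>c\<in>A. \<forall>d\<in>B. smooth_on (snd c ` (fst c \<inter> F -` fst d)) (snd d \<circ> F \<circ> coords_inv c))"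

definition prod_atlas ::
  "('g, 'e) chart set \<Rightarrow> ('h, 'f) chart set \<Rightarrow> ('g \<times> 'h, 'e \<times> 'f) chart set" where
  "prod_atlas A B = {(fst c \<times> fst d, map_prod (snd c) (snd d)) | c d. c \<in> A \<and> d \<in> B}"


section \<open>Vector fields\<close>

text \<open>A vector field is given by its components: \<open>X c p\<close> is the coordinate vector in the chart
  \<open>c\<close> of the value of \<open>X\<close> at the point \<open>p\<close> of the domain of \<open>c\<close>, and the components in different
  charts are related by the derivatives of the transition maps. Components outside the domain of a
  chart of the atlas are set to \<open>0\<close>, so that equality of vector fields is equality of functions.\<close>

type_synonym ('g, 'e) vfield = "('g, 'e) chart \<Rightarrow> 'g \<Rightarrow> 'e"

definition tangent_map ::
  "('g \<Rightarrow> 'h) \<Rightarrow> ('g, 'e::euclidean_space) chart \<Rightarrow> ('h, 'f::euclidean_space) chart \<Rightarrow>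
   'g \<Rightarrow> 'e \<Rightarrow> 'f" where
  "tangent_map F c d p = frechet_derivative (snd d \<circ> F \<circ> coords_inv c) (at (snd c p))"

definition vector_field ::
  "('g, 'e::euclidean_space) chart set \<Rightarrow> ('g, 'e) vfield \<Rightarrow> bool" where
  "vector_field A X \<longleftrightarrow>
     (\<forall>c p. \<not> (c \<in> A \<and> p \<in> fst c) \<longrightarrow> X c p = 0) \<and>
     (\<forall>c\<in>A. smooth_on (snd c ` fst c) (X c \<circ> coords_inv c)) \<and>
     (\<forall>c\<in>A. \<forall>d\<in>A. \<forall>p\<in>fst c \<inter> fst d. X d p = tangent_map id c d p (X c p))"

text \<open>In coordinates, \<open>[X, Y] = DY(X) - DX(Y)\<close>.\<close>

definition vf_bracket ::
  "('g, 'e::euclidean_space) chart set \<Rightarrow> ('g, 'e) vfield \<Rightarrow> ('g, 'e) vfield \<Rightarrow> ('g, 'e) vfield"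
  where
  "vf_bracket A X Y = (\<lambda>c p. if c \<in> A \<and> p \<in> fst c
     then frechet_derivative (Y c \<circ> coords_inv c) (at (snd c p)) (X c p)
        - frechet_derivative (X c \<circ> coords_inv c) (at (snd c p)) (Y c p)
     else 0)"

definition integral_curve ::
  "('g::topological_space, 'e::euclidean_space) chart set \<Rightarrow> ('g, 'e) vfield \<Rightarrow>
   (real \<Rightarrow> 'g) \<Rightarrow> bool" where
  "integral_curve A X \<gamma> \<longleftrightarrow> continuous_on UNIV \<gamma> \<and>
     (\<forall>c\<in>A. \<forall>t. \<gamma> t \<in> fst c \<longrightarrow> (snd c \<circ> \<gamma> has_vector_derivative X c (\<gamma> t)) (at t))"


section \<open>Lie groups and Carnot groups\<close>

definition lie_group ::
  "'g::{t2_space,second_countable_topology} monoid \<Rightarrow> ('g, 'e::euclidean_space) chart set \<Rightarrow> bool"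
  where
  "lie_group G A \<longleftrightarrow> group G \<and> carrier G = UNIV \<and> smooth_atlas A \<and>
     smooth_map (prod_atlas A A) A (\<lambda>(x, y). x \<otimes>\<^bsub>G\<^esub> y) \<and>
     smooth_map A A (\<lambda>x. inv\<^bsub>G\<^esub> x)"

definition lie_algebra ::
  "'g monoid \<Rightarrow> ('g, 'e::euclidean_space) chart set \<Rightarrow> ('g, 'e) vfield set" where
  "lie_algebra G A = {X. vector_field A X \<and>
     (\<forall>a. \<forall>c\<in>A. \<forall>d\<in>A. \<forall>p\<in>fst c. a \<otimes>\<^bsub>G\<^esub> p \<in> fst d \<longrightarrow>
        X d (a \<otimes>\<^bsub>G\<^esub> p) = tangent_map (\<lambda>q. a \<otimes>\<^bsub>G\<^esub> q) c d p (X c p))}"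

definition lexp ::
  "'g::topological_space monoid \<Rightarrow> ('g, 'e::euclidean_space) chart set \<Rightarrow> ('g, 'e) vfield \<Rightarrow> 'g"
  where
  "lexp G A X = (THE \<gamma>. integral_curve A X \<gamma> \<and> \<gamma> 0 = \<one>\<^bsub>G\<^esub>) 1"

text \<open>The layers of the stratification are \<open>V 1, \<dots>, V s\<close>; the value \<open>V 0\<close> plays no role.\<close>

definition stratification ::
  "'g monoid \<Rightarrow> ('g, 'e::euclidean_space) chart set \<Rightarrow> (nat \<Rightarrow> ('g, 'e) vfield set) \<Rightarrow> nat \<Rightarrow> bool"
  where
  "stratification G A V s \<longleftrightarrow> s \<ge> 1 \<and>
     (\<forall>i\<ge>1. subspace (V i) \<and> V i \<subseteq> lie_algebra G A) \<and>
     (\<forall>X\<in>lie_algebra G A. \<exists>!Y. Y \<in> (\<Pi>\<^sub>E i\<in>{1..s}. V i) \<and> X = (\<Sum>i=1..s. Y i)) \<and>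
     (\<forall>i\<in>{1..s}. span {vf_bracket A X Y | X Y. X \<in> V 1 \<and> Y \<in> V i} = V (Suc i)) \<and>
     V s \<noteq> {0} \<and> (\<forall>i>s. V i = {0})"

definition carnot_group ::
  "'g::{t2_space,second_countable_topology} monoid \<Rightarrow> ('g, 'e::euclidean_space) chart set \<Rightarrow>
   (nat \<Rightarrow> ('g, 'e) vfield set) \<Rightarrow> nat \<Rightarrow> bool" where
  "carnot_group G A V s \<longleftrightarrow> lie_group G A \<and> connected (UNIV :: 'g set) \<and>
     simply_connected (UNIV :: 'g set) \<and> stratification G A V s"

text \<open>A scalar product on the first layer is given by a linear isometry \<open>\<iota>\<close> of a standard Euclidean
  space onto it. It also carries over the topology of the first layer as a finite-dimensional
  vector space, which does not depend on \<open>\<iota>\<close>.\<close>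

definition layer_coords ::
  "(nat \<Rightarrow> ('g, 'e::euclidean_space) vfield set) \<Rightarrow> ('m::euclidean_space \<Rightarrow> ('g, 'e) vfield) \<Rightarrow> bool"
  where
  "layer_coords V \<iota> \<longleftrightarrow> linear \<iota> \<and> bij_betw \<iota> UNIV (V 1)"

definition layer_topology ::
  "('m::euclidean_space \<Rightarrow> ('g, 'e::euclidean_space) vfield) \<Rightarrow> ('g, 'e) vfield topology" where
  "layer_topology \<iota> = pullback_topology (range \<iota>) (inv_into UNIV \<iota>) euclidean"

primrec Gamma_prod ::
  "'g::topological_space monoid \<Rightarrow> ('g, 'e::euclidean_space) chart set \<Rightarrow> nat \<Rightarrow>
   (nat \<Rightarrow> ('g, 'e) vfield) \<Rightarrow> 'g" where
  "Gamma_prod G A 0 Y = \<one>\<^bsub>G\<^esub>"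
| "Gamma_prod G A (Suc p) Y = Gamma_prod G A p Y \<otimes>\<^bsub>G\<^esub> lexp G A (Y p)"

definition nbhd_of :: "'a topology \<Rightarrow> 'a \<Rightarrow> 'a set \<Rightarrow> bool" where
  "nbhd_of T a N \<longleftrightarrow> N \<subseteq> topspace T \<and> (\<exists>U. openin T U \<and> a \<in> U \<and> U \<subseteq> N)"

definition open_map_at :: "'a topology \<Rightarrow> 'b topology \<Rightarrow> ('a \<Rightarrow> 'b) \<Rightarrow> 'a \<Rightarrow> bool" where
  "open_map_at S T f a \<longleftrightarrow> (\<forall>N. nbhd_of S a N \<longrightarrow> nbhd_of T (f a) (f ` N))"


section \<open>Haar measures and null sets of lines\<close>

text \<open>(Left) Haar measures on a subgroup \<open>H\<close>, as Borel measures. Regularity is automatic here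
  since the groups are second countable and locally compact.\<close>

definition haar_measure ::
  "'g::topological_space monoid \<Rightarrow> 'g set \<Rightarrow> 'g measure \<Rightarrow> bool" where
  "haar_measure G H M \<longleftrightarrow> sets M = sets (restrict_space borel H) \<and>
     emeasure M H \<noteq> 0 \<and>
     (\<forall>K. compact K \<and> K \<subseteq> H \<longrightarrow> emeasure M K < \<infinity>) \<and>
     (\<forall>h\<in>H. \<forall>B\<in>sets M. emeasure M ((\<lambda>x. h \<otimes>\<^bsub>G\<^esub> x) ` B) = emeasure M B)"

text \<open>The surface measure of the unit sphere of a Euclidean space of dimension \<open>m\<close>: by integration
  in polar coordinates, the measure of a set of directions is \<open>m\<close> times the volume of the cone over
  it in the unit ball.\<close>

definition sphere_measure :: "'m::euclidean_space measure" where
  "sphere_measure = scale_measure (of_nat DIM('m))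
     (distr (restrict_space lborel (cball 0 1 - {0})) (restrict_space borel (sphere 0 1)) sgn)"

text \<open>The subgroup \<open>N\<^sub>X = exp (X\<^sup>\<bottom>)\<close> for \<open>X = \<iota> v\<close>.\<close>

definition slice ::
  "'g::topological_space monoid \<Rightarrow> ('g, 'e::euclidean_space) chart set \<Rightarrow>
   (nat \<Rightarrow> ('g, 'e) vfield set) \<Rightarrow> nat \<Rightarrow> ('m::euclidean_space \<Rightarrow> ('g, 'e) vfield) \<Rightarrow> 'm \<Rightarrow> 'g set"
  where
  "slice G A V s \<iota> v =
     lexp G A ` {\<iota> w + Y | w Y. orthogonal v w \<and> Y \<in> span (\<Union>i\<in>{2..s}. V i)}"

definition slice_measure ::
  "'g::topological_space monoid \<Rightarrow> ('g, 'e::euclidean_space) chart set \<Rightarrow>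
   (nat \<Rightarrow> ('g, 'e) vfield set) \<Rightarrow> nat \<Rightarrow> ('m::euclidean_space \<Rightarrow> ('g, 'e) vfield) \<Rightarrow>
   'g measure \<Rightarrow> 'm \<Rightarrow> 'g measure \<Rightarrow> bool" where
  "slice_measure G A V s \<iota> \<mu> v M \<longleftrightarrow> haar_measure G (slice G A V s \<iota> v) M \<and>
     (\<lambda>(x, t). x \<otimes>\<^bsub>G\<^esub> lexp G A (t *\<^sub>R \<iota> v)) \<in> measurable (M \<Otimes>\<^sub>M lborel) \<mu> \<and>
     distr (M \<Otimes>\<^sub>M lborel) \<mu> (\<lambda>(x, t). x \<otimes>\<^bsub>G\<^esub> lexp G A (t *\<^sub>R \<iota> v)) = \<mu>"

text \<open>The pair \<open>(v, x)\<close> stands for the line \<open>{x exp(tX) | t \<in> \<real>}\<close> oriented by \<open>X = \<iota> v\<close>.\<close>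

definition line_bundle ::
  "'g::topological_space monoid \<Rightarrow> ('g, 'e::euclidean_space) chart set \<Rightarrow>
   (nat \<Rightarrow> ('g, 'e) vfield set) \<Rightarrow> nat \<Rightarrow> ('m::euclidean_space \<Rightarrow> ('g, 'e) vfield) \<Rightarrow> ('m \<times> 'g) set"
  where
  "line_bundle G A V s \<iota> = (SIGMA v:sphere 0 1. slice G A V s \<iota> v)"

text \<open>Null sets for the outer measure extending
  \<open>B \<mapsto> \<integral> \<mu>\<^sub>X {x \<in> N\<^sub>X. (X, x) \<in> B} d\<sigma>(X)\<close>. In a Carnot group the normalized Haar measures
  \<open>\<mu>\<^sub>X\<close>, here \<open>\<nu> v\<close>, exist and are unique, and the integrand is measurable for every Borel set \<open>B\<close>.\<close>

definition null_lines ::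
  "'g::topological_space monoid \<Rightarrow> ('g, 'e::euclidean_space) chart set \<Rightarrow>
   (nat \<Rightarrow> ('g, 'e) vfield set) \<Rightarrow> nat \<Rightarrow> ('m::euclidean_space \<Rightarrow> ('g, 'e) vfield) \<Rightarrow>
   'g measure \<Rightarrow> ('m \<times> 'g) set \<Rightarrow> bool" where
  "null_lines G A V s \<iota> \<mu> L \<longleftrightarrow>
     (\<exists>\<nu>. (\<forall>v\<in>sphere 0 1. slice_measure G A V s \<iota> \<mu> v (\<nu> v)) \<and>
       (\<exists>B\<in>sets (restrict_space borel (line_bundle G A V s \<iota>)). L \<subseteq> B \<and>
          (\<lambda>v. emeasure (\<nu> v) {x. (v, x) \<in> B}) \<in> borel_measurable sphere_measure \<and>
          (\<integral>\<^sup>+v. emeasure (\<nu> v) {x. (v, x) \<in> B} \<partial>sphere_measure) = 0))"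


section \<open>Monotone sets\<close>

definition line_monotone ::
  "'g::topological_space monoid \<Rightarrow> ('g, 'e::euclidean_space) chart set \<Rightarrow> 'g set \<Rightarrow> 'g \<Rightarrow>
   ('g, 'e) vfield \<Rightarrow> bool" where
  "line_monotone G A E x X \<longleftrightarrow> (\<exists>f :: real \<Rightarrow> real. (mono f \<or> antimono f) \<and>
     (AE t in lborel. indicator E (x \<otimes>\<^bsub>G\<^esub> lexp G A (t *\<^sub>R X)) = f t))"

definition monotone_set ::
  "'g::topological_space monoid \<Rightarrow> ('g, 'e::euclidean_space) chart set \<Rightarrow>
   (nat \<Rightarrow> ('g, 'e) vfield set) \<Rightarrow> nat \<Rightarrow> ('m::euclidean_space \<Rightarrow> ('g, 'e) vfield) \<Rightarrow>
   'g measure \<Rightarrow> 'g set \<Rightarrow> bool" where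
  "monotone_set G A V s \<iota> \<mu> E \<longleftrightarrow> E \<in> sets (completion \<mu>) \<and>
     null_lines G A V s \<iota> \<mu>
       {(v, x) \<in> line_bundle G A V s \<iota>. \<not> line_monotone G A E x (\<iota> v)}"

definition line_set ::
  "'g::topological_space monoid \<Rightarrow> ('g, 'e::euclidean_space) chart set \<Rightarrow> 'g \<Rightarrow>
   ('g, 'e) vfield \<Rightarrow> 'g set" where
  "line_set G A x X = range (\<lambda>t::real. x \<otimes>\<^bsub>G\<^esub> lexp G A (t *\<^sub>R X))"

definition precisely_monotone ::
  "'g::topological_space monoid \<Rightarrow> ('g, 'e::euclidean_space) chart set \<Rightarrow>
   (nat \<Rightarrow> ('g, 'e) vfield set) \<Rightarrow> 'g set \<Rightarrow> bool" where
  "precisely_monotone G A V E \<longleftrightarrow> (\<forall>X\<in>V 1 - {0}. \<forall>x.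
     connected (E \<inter> line_set G A x X) \<and> connected (line_set G A x X - E))"

definition spt_meas :: "'g::topological_space measure \<Rightarrow> 'g set \<Rightarrow> 'g set" where
  "spt_meas \<mu> E = {x. \<forall>U. open U \<and> x \<in> U \<longrightarrow> emeasure (completion \<mu>) (E \<inter> U) > 0}"

definition Int_meas :: "'g::topological_space measure \<Rightarrow> 'g set \<Rightarrow> 'g set" where
  "Int_meas \<mu> E = - spt_meas \<mu> (- E)"

end

theory Submission
  imports Defs
begin

text \<open>
  Call \<open>x\<close> an interior point of \<open>E\<close> if almost every point of a neighbourhood of \<open>x\<close> is in \<open>E\<close>. The
  monotonicity of almost every line says that for almost every direction \<open>Y\<close> and all \<open>0 < a < b\<close>,
  for almost every \<open>u\<close> it does not happen that \<open>u\<close> and \<open>u exp(bY)\<close> are in \<open>E\<close> while \<open>u exp(aY)\<close> is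
  not, and the same for the complement of \<open>E\<close>. Right translations act continuously in \<open>L\<^sup>1\<close>, so this
  extends to all directions \<open>Y\<close>.

  It follows that on a line the interior points of \<open>E\<close> form an interval. For the support, suppose that
  \<open>x\<close> and \<open>x exp(tX)\<close> are in the support of \<open>E\<close> and that some \<open>z = x exp(cX)\<close> with \<open>0 < c < t\<close> is not.
  If \<open>u\<close> is near \<open>x\<close> and in \<open>E\<close> then, as the line from \<open>u\<close> in a direction \<open>Y\<close> near \<open>X\<close> passes near \<open>z\<close>,
  \<open>u exp(-Y)\<close> is in \<open>E\<close> as well; the point \<open>u exp(-Y\<^sub>1)\<close> plays the same role, and iterating one obtains that
  \<open>u exp(-Y\<^sub>1) \<dots> exp(-Y\<^sub>p)\<close> is in \<open>E\<close> for almost every \<open>u\<close>. Since \<open>\<Gamma>\<^sub>p\<close> is open at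
  \<open>(-X, \<dots>, -X)\<close>, Fubini's theorem shows that \<open>x exp(-pX)\<close> is an interior point of \<open>E\<close>. Now the line
  meets in this order the interior of \<open>E\<close>, the interior of its complement and the support of \<open>E\<close>, which is
  impossible.
\<close>

section \<open>Translations and Haar measure\<close>

locale topological_group = group G for G :: "'g::{t2_space,second_countable_topology} monoid" (structure) +
  assumes carrier_UNIV [simp]: "carrier G = UNIV"
    and continuous_mult: "continuous_on UNIV (\<lambda>(x, y). x \<otimes> y)"
    and continuous_inv: "continuous_on UNIV (\<lambda>x. inv x)"
begin

lemma mem_carrier [simp, intro]: "x \<in> carrier G"
  by simp

text \<open>Second countability makes the product sigma-algebra the Borel sigma-algebra of the
  product, so continuity of the multiplication gives joint measurability, as required for Fubini's
  theorem.\<close>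

lemma measurable_mult [measurable (raw)]:
  assumes [measurable]: "f \<in> borel_measurable M" "h \<in> borel_measurable M"
  shows "(\<lambda>x. f x \<otimes> h x) \<in> borel_measurable M"
proof -
  have [measurable]: "(\<lambda>p. fst p \<otimes> snd p) \<in> borel_measurable (borel \<Otimes>\<^sub>M borel)"
    using continuous_mult
    by (simp add: borel_prod case_prod_unfold borel_measurable_continuous_onI)
  have "(\<lambda>x. (\<lambda>p. fst p \<otimes> snd p) (f x, h x)) \<in> borel_measurable M"
    by measurable
  then show ?thesis by simp
qed

lemma measurable_inv [measurable (raw)]:
  assumes [measurable]: "f \<in> borel_measurable M"
  shows "(\<lambda>x. inv (f x)) \<in> borel_measurable M"
  using measurable_compose [OF assms borel_measurable_continuous_onI [OF continuous_inv]] .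

lemma tendsto_mult [tendsto_intros]:
  assumes "(f \<longlongrightarrow> a) F" "(h \<longlongrightarrow> b) F"
  shows "((\<lambda>x. f x \<otimes> h x) \<longlongrightarrow> a \<otimes> b) F"
proof -
  have "isCont (\<lambda>(x, y). x \<otimes> y) (a, b)"
    using continuous_mult by (simp add: continuous_on_eq_continuous_at)
  from isCont_tendsto_compose [OF this tendsto_Pair [OF assms]] show ?thesis by simp
qed

lemma tendsto_inv [tendsto_intros]:
  assumes "(f \<longlongrightarrow> a) F"
  shows "((\<lambda>x. inv (f x)) \<longlongrightarrow> inv a) F"
proof -
  have "isCont (\<lambda>x. inv x) a"
    using continuous_inv by (simp add: continuous_on_eq_continuous_at)
  from isCont_tendsto_compose [OF this assms] show ?thesis .
qed

lemma continuous_on_mult [continuous_intros]: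
  assumes "continuous_on S f" "continuous_on S h"
  shows "continuous_on S (\<lambda>x. f x \<otimes> h x)"
  using assms by (simp add: continuous_on_def tendsto_mult)

lemma continuous_on_inv [continuous_intros]:
  assumes "continuous_on S f"
  shows "continuous_on S (\<lambda>x. inv (f x))"
  using assms by (simp add: continuous_on_def tendsto_inv)

lemma inv_mult_cancel [simp]: "inv g \<otimes> (g \<otimes> x) = x" "g \<otimes> (inv g \<otimes> x) = x"
  by (simp_all flip: m_assoc)

lemma open_translate: "open W \<Longrightarrow> open {u. u \<otimes> g \<in> W}"
  using open_vimage [OF _ continuous_on_mult [OF continuous_on_id continuous_on_const [of UNIV g]], of W]
  by (simp add: vimage_def)

lemma open_inv_translate: "open W \<Longrightarrow> open {u. inv u \<otimes> g \<in> W}"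
  using open_vimage [OF _ continuous_on_mult [OF continuous_on_inv [OF continuous_on_id] continuous_on_const [of UNIV g]], of W]
  by (simp add: vimage_def)

end

locale haar_group = topological_group G
  for G :: "'g::{t2_space,second_countable_topology} monoid" (structure) +
  fixes \<mu> :: "'g measure"
  assumes locally_compact: "\<And>x::'g. \<exists>U K. open U \<and> x \<in> U \<and> U \<subseteq> K \<and> compact K"
    and haar: "haar_measure G UNIV \<mu>"
begin

lemma sets_haar [measurable_cong, simp]: "sets \<mu> = sets borel"
  using haar by (simp add: haar_measure_def)

lemma space_haar [simp]: "space \<mu> = UNIV"
  using sets_eq_imp_space_eq [OF sets_haar] by simp

section \<open>Null sets under translations and inversion\<close>

lemma AE_left:
  assumes "AE x in \<mu>. P x"
  shows "AE x in \<mu>. P (g \<otimes> x)"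
proof -
  obtain N where N': "\<And>x. x \<in> space \<mu> - N \<Longrightarrow> P x" and "N \<in> null_sets \<mu>"
    by (rule AE_E3 [OF assms]) blast
  then have N: "{x. \<not> P x} \<subseteq> N" "N \<in> null_sets \<mu>"
    by auto
  let ?N = "(\<lambda>x. inv g \<otimes> x) ` N"
  have eq: "?N = (\<lambda>x. g \<otimes> x) -` N"
    by (auto simp: image_iff intro!: bexI [of _ "g \<otimes> _"])
  have "(\<lambda>x. g \<otimes> x) -` N \<inter> space borel \<in> sets borel"
    using N by (intro measurable_sets [where A = borel]) auto
  moreover have "emeasure \<mu> ?N = emeasure \<mu> N"
    using haar N by (auto simp: haar_measure_def)
  ultimately have "?N \<in> null_sets \<mu>"
    using N eq by (auto simp: null_sets_def)
  moreover have "{x. \<not> P (g \<otimes> x)} \<subseteq> ?N"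
    using N eq by auto
  ultimately show ?thesis by (auto intro: AE_I')
qed

lemma finite_open_nbhd: "\<exists>U. open U \<and> x \<in> U \<and> emeasure \<mu> U < \<infinity>"
proof -
  obtain U K where UK: "open U" "x \<in> U" "U \<subseteq> K" "compact K"
    using locally_compact by blast
  have "emeasure \<mu> U \<le> emeasure \<mu> K"
    using UK by (intro emeasure_mono) (auto intro: borel_closed compact_imp_closed)
  also have "\<dots> < \<infinity>"
    using haar UK by (auto simp: haar_measure_def)
  finally show ?thesis using UK by blast
qed

sublocale haar: sigma_finite_measure \<mu>
proof
  let ?F = "{U. open U \<and> emeasure \<mu> U < \<infinity>}"
  obtain F' where F': "F' \<subseteq> ?F" "countable F'" "\<Union>F' = \<Union>?F"
    using Lindelof [of ?F] by auto
  have "\<Union>?F = UNIV"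
    using finite_open_nbhd by auto
  then show "\<exists>A. countable A \<and> A \<subseteq> sets \<mu> \<and> \<Union>A = space \<mu> \<and> (\<forall>a\<in>A. emeasure \<mu> a \<noteq> \<infinity>)"
    using F' by (intro exI [of _ F']) (auto simp: less_top)
qed

sublocale haar2: pair_sigma_finite \<mu> \<mu> ..

lemma AE_ex:
  assumes "AE x in \<mu>. P x"
  shows "\<exists>x. P x"
proof (rule ccontr)
  assume "\<nexists>x. P x"
  then have "AE x in \<mu>. False" using assms by simp
  then have "UNIV \<in> null_sets \<mu>" by (simp add: AE_iff_null_sets [of UNIV])
  then show False using haar by (auto simp: haar_measure_def)
qed

text \<open>For a null set \<open>N\<close>, left invariance gives
  \<open>inv y \<otimes> x \<notin> N\<close> for every \<open>y\<close> and almost every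
  \<open>x\<close>. By Fubini's theorem there is one \<open>x\<close> for which this holds for
  almost every \<open>y\<close>, and the substitution \<open>y = x \<otimes> z\<close> turns it into
  \<open>inv z \<notin> N\<close>.\<close>

lemma AE_inverse:
  assumes "AE x in \<mu>. P x"
  shows "AE x in \<mu>. P (inv x)"
proof -
  obtain N where N': "\<And>x. x \<in> space \<mu> - N \<Longrightarrow> P x" and "N \<in> null_sets \<mu>"
    by (rule AE_E3 [OF assms]) blast
  then have N: "{x. \<not> P x} \<subseteq> N" "N \<in> null_sets \<mu>"
    by auto
  have [measurable]: "N \<in> sets borel" using N by auto
  have "AE x in \<mu>. x \<notin> N" using N by (simp add: AE_not_in)
  then have "AE x in \<mu>. inv y \<otimes> x \<notin> N" for y
    by (rule AE_left)
  then have "AE y in \<mu>. AE x in \<mu>. inv y \<otimes> x \<notin> N"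
    by simp
  moreover have "{p \<in> space (\<mu> \<Otimes>\<^sub>M \<mu>). inv (fst p) \<otimes> snd p \<notin> N} \<in> sets (\<mu> \<Otimes>\<^sub>M \<mu>)"
    by measurable
  ultimately have "AE x in \<mu>. AE y in \<mu>. inv y \<otimes> x \<notin> N"
    by (subst haar2.AE_commute [symmetric]) auto
  then obtain x where "AE y in \<mu>. inv y \<otimes> x \<notin> N"
    using AE_ex by blast
  from AE_left [OF this, of x] have "AE z in \<mu>. inv z \<notin> N"
    by (simp add: inv_mult_group m_assoc)
  then show ?thesis using N by (auto elim!: eventually_mono)
qed

text \<open>A right translation is a left translation conjugated by inversion.\<close>

lemma AE_right:
  assumes "AE x in \<mu>. P x"
  shows "AE x in \<mu>. P (x \<otimes> g)"
proof -
  have "AE x in \<mu>. P (inv (inv g \<otimes> inv x))"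
    using AE_inverse [OF AE_left [OF AE_inverse [OF assms], of "inv g"]] .
  then show ?thesis by (simp add: inv_mult_group)
qed

section \<open>A right-invariant measure\<close>

lemma emeasure_left:
  assumes "B \<in> sets borel"
  shows "emeasure \<mu> ((\<lambda>x. g \<otimes> x) -` B) = emeasure \<mu> B"
proof -
  have "(\<lambda>x. g \<otimes> x) -` B = (\<lambda>x. inv g \<otimes> x) ` B"
    by (auto simp: image_iff intro!: bexI [of _ "g \<otimes> _"])
  then show ?thesis
    using haar assms by (auto simp: haar_measure_def)
qed

text \<open>The image of a left Haar measure under inversion is a right Haar measure. It has the
  same null sets as \<open>\<mu>\<close>, and right translations preserve it, which makes it the
  measure in which to compare right translates of a set.\<close>

definition right_haar :: "'g measure" where
  "right_haar = distr \<mu> borel (\<lambda>x. inv x)"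

lemma sets_right_haar [measurable_cong, simp]: "sets right_haar = sets borel"
  by (simp add: right_haar_def)

lemma space_right_haar [simp]: "space right_haar = UNIV"
  by (simp add: right_haar_def)

lemma emeasure_right_haar:
  "B \<in> sets borel \<Longrightarrow> emeasure right_haar B = emeasure \<mu> ((\<lambda>x. inv x) -` B)"
  by (simp add: right_haar_def emeasure_distr)

lemma vimage_borel [measurable]:
  assumes [measurable]: "B \<in> sets borel" "f \<in> borel_measurable borel"
  shows "f -` B \<in> sets borel"
  using measurable_sets [OF assms(2,1)] by simp

lemma emeasure_right_haar_translate:
  assumes [measurable]: "B \<in> sets borel"
  shows "emeasure right_haar ((\<lambda>x. x \<otimes> g) -` B) = emeasure right_haar B"
proof -
  have "(\<lambda>x. inv x) -` (\<lambda>x. x \<otimes> g) -` B = (\<lambda>x. inv g \<otimes> x) -` (\<lambda>x. inv x) -` B"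
    by (auto simp: inv_mult_group)
  then show ?thesis
    by (simp add: emeasure_right_haar emeasure_left)
qed

lemma null_right_haar_iff:
  assumes [measurable]: "B \<in> sets borel"
  shows "emeasure right_haar B = 0 \<longleftrightarrow> emeasure \<mu> B = 0"
proof -
  have null: "emeasure \<mu> C = 0 \<longleftrightarrow> (AE x in \<mu>. x \<notin> C)" if "C \<in> sets borel" for C
    using that by (subst AE_iff_null_sets [symmetric]) (auto simp: null_sets_def)
  have "(AE x in \<mu>. inv x \<notin> B) \<longleftrightarrow> (AE x in \<mu>. x \<notin> B)"
    using AE_inverse [of "\<lambda>x. inv x \<notin> B"] by (intro iffI AE_inverse) simp_all
  then show ?thesis
    by (simp add: emeasure_right_haar null)
qed

lemma right_haar_finite_nbhd:
  "\<exists>U. open U \<and> x \<in> U \<and> U \<in> fmeasurable right_haar"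
proof -
  obtain U K where UK: "open U" "x \<in> U" "U \<subseteq> K" "compact K"
    using locally_compact by blast
  have K: "K \<in> sets borel"
    using UK by (auto intro: borel_closed compact_imp_closed)
  have "(\<lambda>x. inv x) -` K = (\<lambda>x. inv x) ` K"
    by (auto simp: image_iff intro!: bexI [of _ "inv _"])
  moreover have "compact ((\<lambda>x. inv x) ` K)"
    using UK by (intro compact_continuous_image continuous_on_inv continuous_on_id)
  ultimately have "emeasure right_haar K < \<infinity>"
    using haar K by (auto simp: haar_measure_def emeasure_right_haar)
  then have "K \<in> fmeasurable right_haar" using K by (auto simp: fmeasurable_def)
  from fmeasurableI2 [OF this, of U] have "U \<in> fmeasurable right_haar"
    using UK by auto
  then show ?thesis using UK by blast
qed

section \<open>Continuity of right translations in measure\<close>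

lemma vimage_fmeasurable:
  assumes "B \<in> fmeasurable right_haar"
  shows "(\<lambda>x. x \<otimes> g) -` B \<in> fmeasurable right_haar"
    and "measure right_haar ((\<lambda>x. x \<otimes> g) -` B) = measure right_haar B"
proof -
  have [measurable]: "B \<in> sets borel" using assms by (auto simp: fmeasurable_def)
  show "(\<lambda>x. x \<otimes> g) -` B \<in> fmeasurable right_haar"
    using assms emeasure_right_haar_translate [of B g] by (auto simp: fmeasurable_def)
  show "measure right_haar ((\<lambda>x. x \<otimes> g) -` B) = measure right_haar B"
    by (simp add: measure_def emeasure_right_haar_translate)
qed

text \<open>As \<open>Q\<close> is open, each \<open>u\<close> with
  \<open>u \<otimes> g \<in> Q\<close> satisfies \<open>u \<otimes> k n \<in> Q\<close> from some
  \<open>n\<close> on. The unions of the tails of the exceptional sets thus decrease to the empty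
  set, inside the set \<open>W\<close> of finite measure.\<close>

lemma measure_leave_open:
  assumes "open Q" and [measurable]: "W \<in> fmeasurable right_haar" and "k \<longlonglongrightarrow> g"
  shows "(\<lambda>n. measure right_haar {u \<in> W. u \<otimes> g \<in> Q \<and> u \<otimes> k n \<notin> Q}) \<longlonglongrightarrow> 0"
proof -
  have [measurable]: "W \<in> sets borel" "Q \<in> sets borel"
    using assms by (auto simp: fmeasurable_def)
  define A where "A n = {u \<in> W. u \<otimes> g \<in> Q \<and> u \<otimes> k n \<notin> Q}" for n
  define B where "B n = (\<Union>m\<in>{n..}. A m)" for n
  have [measurable]: "A n \<in> sets borel" for n
    unfolding A_def by measurable
  have [measurable]: "B n \<in> sets borel" for n
    unfolding B_def by measurable
  have BW: "B n \<in> fmeasurable right_haar" for n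
    by (intro fmeasurableI2 [OF assms(2)]) (auto simp: A_def B_def)
  have "(\<Inter>n. B n) = {}"
  proof -
    have "u \<notin> (\<Inter>n. B n)" for u
    proof (cases "u \<otimes> g \<in> Q")
      case True
      have "(\<lambda>n. u \<otimes> k n) \<longlonglongrightarrow> u \<otimes> g"
        using assms by (intro tendsto_intros)
      then have "eventually (\<lambda>n. u \<otimes> k n \<in> Q) sequentially"
        using assms True by (intro topological_tendstoD)
      then obtain N where "\<forall>n\<ge>N. u \<otimes> k n \<in> Q" by (auto simp: eventually_sequentially)
      then have "u \<notin> B N" by (auto simp: A_def B_def)
      then show ?thesis by blast
    qed (auto simp: A_def B_def)
    then show ?thesis by blast
  qed
  moreover have "range B \<subseteq> sets right_haar"
    by auto
  moreover have "decseq B"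
    by (force simp: B_def decseq_def)
  moreover have "emeasure right_haar (B n) \<noteq> \<infinity>" for n
    using BW [of n] by (auto simp: fmeasurable_def)
  ultimately have "(\<lambda>n. measure right_haar (B n)) \<longlonglongrightarrow> measure right_haar {}"
    using Lim_measure_decseq [of B right_haar] by simp
  then have lim: "(\<lambda>n. measure right_haar (B n)) \<longlonglongrightarrow> 0" by simp
  have "measure right_haar (A n) \<le> measure right_haar (B n)" for n
    using BW by (intro measure_mono_fmeasurable) (auto simp: B_def)
  then show ?thesis
    unfolding A_def [symmetric]
    by (intro tendsto_sandwich [OF _ _ tendsto_const lim]) auto
qed

text \<open>This is the continuity of right translation in L^1, localized to a set \<open>W\<close>
  whose translates stay in a set \<open>K\<close> of finite measure. It is proved for open sets,
  which form an intersection-stable generator of the Borel sets, and carried through complements and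
  disjoint unions.\<close>

lemma measure_translate_tendsto:
  assumes Q: "Q \<in> sets borel" and W [measurable]: "W \<in> sets borel"
    and K: "K \<in> fmeasurable right_haar" and k: "k \<longlonglongrightarrow> g"
    and WK: "\<And>u. u \<in> W \<Longrightarrow> u \<otimes> g \<in> K" "\<And>u n. u \<in> W \<Longrightarrow> u \<otimes> k n \<in> K"
  shows "(\<lambda>n. measure right_haar {u \<in> W. (u \<otimes> g \<in> Q) \<noteq> (u \<otimes> k n \<in> Q)}) \<longlonglongrightarrow> 0"
proof -
  have [measurable]: "K \<in> sets borel" using K by (auto simp: fmeasurable_def)
  have Wf: "W \<in> fmeasurable right_haar"
    using WK by (intro fmeasurableI2 [OF vimage_fmeasurable(1) [OF K, of g]]) auto
  define S where "S n Q = {u \<in> W. (u \<otimes> g \<in> Q) \<noteq> (u \<otimes> k n \<in> Q)}" for n Q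
  have S_meas [measurable]: "S n Q \<in> sets borel" if [measurable]: "Q \<in> sets borel" for n Q
    unfolding S_def by measurable
  have S_fin: "S n Q \<in> fmeasurable right_haar" if "Q \<in> sets borel" for n Q
    using that by (intro fmeasurableI2 [OF Wf]) (auto simp: S_def)
  have "Int_stable {T::'g set. open T}" "{T::'g set. open T} \<subseteq> Pow UNIV"
    "Q \<in> sigma_sets UNIV {T. open T}"
    using Q by (auto simp: borel_def Int_stable_def)
  then have "(\<lambda>n. measure right_haar (S n Q)) \<longlonglongrightarrow> 0"
  proof (induction Q rule: sigma_sets_induct_disjoint)
    case (basic Q)
    then have [simp]: "open Q" by simp
    then have [measurable]: "Q \<in> sets borel" by simp
    \<comment> \<open>\<open>A n\<close> consists of the points that leave \<open>Q\<close>. A point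
      \<open>u\<close> that enters \<open>Q\<close> is treated through
      \<open>v = u \<otimes> k n\<close>, which lies in \<open>Q\<close> while
      \<open>v \<otimes> (inv (k n) \<otimes> g)\<close> does not; this multiplier tends to
      \<open>\<one>\<close>, so \<open>measure_leave_open\<close> applies to \<open>B n\<close> as
      well.\<close>
    define A B where "A n = {u \<in> W. u \<otimes> g \<in> Q \<and> u \<otimes> k n \<notin> Q}"
      and "B n = {v \<in> K. v \<otimes> \<one> \<in> Q \<and> v \<otimes> (inv (k n) \<otimes> g) \<notin> Q}" for n
    have [measurable]: "A n \<in> sets borel" "B n \<in> sets borel" for n
      unfolding A_def B_def by measurable
    have Bf: "B n \<in> fmeasurable right_haar" for n
      by (intro fmeasurableI2 [OF K]) (auto simp: B_def)
    have Af: "A n \<in> fmeasurable right_haar" for n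
      by (intro fmeasurableI2 [OF Wf]) (auto simp: A_def)
    have "(\<lambda>n. inv (k n) \<otimes> g) \<longlonglongrightarrow> inv g \<otimes> g"
      using k by (intro tendsto_intros)
    then have lim: "(\<lambda>n. measure right_haar (A n) + measure right_haar (B n)) \<longlonglongrightarrow> 0 + 0"
      unfolding A_def B_def using k K Wf
      by (intro tendsto_add measure_leave_open) auto
    have "measure right_haar (S n Q) \<le> measure right_haar (A n) + measure right_haar (B n)" for n
    proof -
      have "S n Q \<subseteq> A n \<union> (\<lambda>u. u \<otimes> k n) -` B n"
        using WK by (auto simp: S_def A_def B_def m_assoc)
      then have "measure right_haar (S n Q) \<le> measure right_haar (A n \<union> (\<lambda>u. u \<otimes> k n) -` B n)"
        using vimage_fmeasurable [OF Bf [of n], of "k n"] Af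
        by (intro measure_mono_fmeasurable) (auto intro: fmeasurable.Un)
      also have "\<dots> \<le> measure right_haar (A n) + measure right_haar ((\<lambda>u. u \<otimes> k n) -` B n)"
        by (intro measure_Un_le) auto
      finally show ?thesis using vimage_fmeasurable [OF Bf [of n], of "k n"] by simp
    qed
    then show ?case
      by (intro tendsto_sandwich [OF _ _ tendsto_const lim [simplified]]) auto
  next
    case empty
    then show ?case by (simp add: S_def)
  next
    case (compl Q)
    have "S n (UNIV - Q) = S n Q" for n by (auto simp: S_def)
    then show ?case using compl by simp
  next
    case (union F)
    have [measurable]: "F i \<in> sets borel" for i
      using union by (auto simp: borel_def)
    \<comment> \<open>As the sets \<open>F i\<close> are disjoint, a point lies in at most one of
      them, and the tails \<open>T N\<close> decrease to the empty set.\<close>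
    define T where "T N = K \<inter> (\<Union>i\<in>{N..}. F i)" for N
    have [measurable]: "T N \<in> sets borel" for N
      unfolding T_def by measurable
    have Tf: "T N \<in> fmeasurable right_haar" for N
      by (intro fmeasurableI2 [OF K]) (auto simp: T_def)
    have "u \<notin> (\<Inter>N. T N)" for u
    proof (cases "\<exists>i. u \<in> F i")
      case True
      then obtain i where "u \<in> F i" by blast
      then have "u \<notin> F j" if "j \<ge> Suc i" for j
        using disjoint_family_onD [OF union(1), of i j] that by auto
      then have "u \<notin> T (Suc i)" by (auto simp: T_def)
      then show ?thesis by blast
    qed (auto simp: T_def)
    then have "(\<Inter>N. T N) = {}" by blast
    moreover have "range T \<subseteq> sets right_haar"
      by auto
    moreover have "decseq T"
      by (force simp: T_def decseq_def)
    moreover have "emeasure right_haar (T n) \<noteq> \<infinity>" for n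
      using Tf [of n] by (auto simp: fmeasurable_def)
    ultimately have "(\<lambda>n. measure right_haar (T n)) \<longlonglongrightarrow> measure right_haar {}"
      using Lim_measure_decseq [of T right_haar] by simp
    then have limT: "(\<lambda>n. measure right_haar (T n)) \<longlonglongrightarrow> 0" by simp
    \<comment> \<open>If membership in the union changes, then membership in some \<open>F i\<close>
      changes. Either \<open>i < N\<close>, or one of the two translates of \<open>u\<close> lies in
      \<open>T N\<close>; these two possibilities give the factor 2.\<close>
    have bound: "measure right_haar (S n (\<Union>(range F)))
        \<le> (\<Sum>i<N. measure right_haar (S n (F i))) + 2 * measure right_haar (T N)" for n N
    proof -
      let ?g = "(\<lambda>u. u \<otimes> g) -` T N" and ?k = "(\<lambda>u. u \<otimes> k n) -` T N"
      let ?S = "\<Union>i<N. S n (F i)"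
      have fin: "?S \<in> fmeasurable right_haar" "?g \<in> fmeasurable right_haar" "?k \<in> fmeasurable right_haar"
        using S_fin vimage_fmeasurable [OF Tf [of N]] by (auto intro!: fmeasurable.finite_UN)
      have "S n (\<Union>(range F)) \<subseteq> (?S \<union> ?g) \<union> ?k"
      proof
        fix u assume u: "u \<in> S n (\<Union>(range F))"
        then have "u \<in> W" by (simp add: S_def)
        have "(\<exists>i. u \<otimes> g \<in> F i) \<noteq> (\<exists>i. u \<otimes> k n \<in> F i)"
          using u by (simp add: S_def)
        moreover have "(\<exists>i. u \<otimes> g \<in> F i) = (\<exists>i. u \<otimes> k n \<in> F i)"
          if "\<And>i. (u \<otimes> g \<in> F i) = (u \<otimes> k n \<in> F i)"
          using that by simp
        ultimately obtain i where "(u \<otimes> g \<in> F i) \<noteq> (u \<otimes> k n \<in> F i)" by blast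
        then show "u \<in> (?S \<union> ?g) \<union> ?k"
          using \<open>u \<in> W\<close> WK by (cases "i < N") (auto simp: S_def T_def not_less)
      qed
      then have "measure right_haar (S n (\<Union>(range F))) \<le> measure right_haar ((?S \<union> ?g) \<union> ?k)"
        using fin by (intro measure_mono_fmeasurable) (auto intro!: fmeasurable.Un)
      also have "\<dots> \<le> measure right_haar (?S \<union> ?g) + measure right_haar ?k"
        using fin by (intro measure_Un_le) auto
      also have "measure right_haar (?S \<union> ?g) \<le> measure right_haar ?S + measure right_haar ?g"
        using fin by (intro measure_Un_le) auto
      also have "measure right_haar ?S \<le> (\<Sum>i<N. measure right_haar (S n (F i)))"
        using S_fin by (intro measure_UNION_le) auto
      finally show ?thesis using vimage_fmeasurable(2) [OF Tf [of N]] by simp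
    qed
    show ?case
    proof (rule LIMSEQ_I)
      fix r :: real assume "r > 0"
      then have "eventually (\<lambda>N. measure right_haar (T N) < r / 4) sequentially"
        using limT by (intro order_tendstoD) auto
      then obtain N where N: "measure right_haar (T N) < r / 4"
        by (auto simp: eventually_sequentially)
      have "(\<lambda>n. \<Sum>i<N. measure right_haar (S n (F i))) \<longlonglongrightarrow> (\<Sum>i<N. 0)"
        using union by (intro tendsto_sum) auto
      then have "eventually (\<lambda>n. (\<Sum>i<N. measure right_haar (S n (F i))) < r / 2) sequentially"
        using \<open>r > 0\<close> by (intro order_tendstoD) auto
      then obtain M where M: "\<And>n. n \<ge> M \<Longrightarrow> (\<Sum>i<N. measure right_haar (S n (F i))) < r / 2"
        by (auto simp: eventually_sequentially)
      have "measure right_haar (S n (\<Union>(range F))) < r" if "n \<ge> M" for n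
        using bound [of n N] M [OF that] N by simp
      then show "\<exists>M. \<forall>n\<ge>M. norm (measure right_haar (S n (\<Union>(range F))) - 0) < r"
        by auto
    qed
  qed
  then show ?thesis by (simp add: S_def)
qed

text \<open>Off sets of small measure, a point satisfying the condition for \<open>g\<close> and
  \<open>h\<close> satisfies it for \<open>k n\<close> and \<open>l n\<close>, which happens only on
  a null set. Since the measure is only locally finite, the estimate is made on each of countably
  many open sets that cover the group.\<close>

lemma AE_translate_limit:
  assumes [measurable]: "P \<in> sets borel" "Q \<in> sets borel" "R \<in> sets borel"
    and k: "k \<longlonglongrightarrow> g" and l: "l \<longlonglongrightarrow> h"
    and null: "\<And>n::nat. AE u in \<mu>. \<not> (u \<in> P \<and> u \<otimes> k n \<in> Q \<and> u \<otimes> l n \<in> R)"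
  shows "AE u in \<mu>. \<not> (u \<in> P \<and> u \<otimes> g \<in> Q \<and> u \<otimes> h \<in> R)"
proof -
  define B where "B = {u. u \<in> P \<and> u \<otimes> g \<in> Q \<and> u \<otimes> h \<in> R}"
  have B_meas [measurable]: "B \<in> sets borel"
    unfolding B_def by measurable
  \<comment> \<open>On such a \<open>W\<close> the translates by the limits and by all late terms
    stay in sets of finite measure, as \<open>measure_translate_tendsto\<close> requires.\<close>
  define good where "good W \<longleftrightarrow> (\<exists>K L N. K \<in> fmeasurable right_haar \<and> L \<in> fmeasurable right_haar
    \<and> (\<forall>u\<in>W. u \<otimes> g \<in> K \<and> u \<otimes> h \<in> L \<and> (\<forall>n\<ge>N. u \<otimes> k n \<in> K \<and> u \<otimes> l n \<in> L)))" for W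
  have nbhd: "\<exists>W K N. open W \<and> x \<in> W \<and> K \<in> fmeasurable right_haar \<and>
     (\<forall>u\<in>W. u \<otimes> g \<in> K \<and> (\<forall>n\<ge>N. u \<otimes> k n \<in> K))" if k: "k \<longlonglongrightarrow> g" for x k g
  proof -
    obtain K where K: "open K" "x \<otimes> g \<in> K" "K \<in> fmeasurable right_haar"
      using right_haar_finite_nbhd by blast
    have "((\<lambda>p. fst p \<otimes> snd p) \<longlongrightarrow> x \<otimes> g) (nhds (x, g))"
      by (intro tendsto_intros) (auto simp: nhds_prod intro: filterlim_fst filterlim_snd)
    then have "eventually (\<lambda>p. fst p \<otimes> snd p \<in> K) (nhds (x, g))"
      using K by (intro topological_tendstoD)
    then obtain W D where WD: "open W" "x \<in> W" "open D" "g \<in> D" "\<And>u d. u \<in> W \<Longrightarrow> d \<in> D \<Longrightarrow> u \<otimes> d \<in> K"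
      unfolding nhds_prod eventually_prod_filter eventually_nhds by (metis fst_conv snd_conv)
    have "eventually (\<lambda>n. k n \<in> D) sequentially"
      using k WD by (intro topological_tendstoD)
    then obtain N where "\<And>n. n \<ge> N \<Longrightarrow> k n \<in> D" by (auto simp: eventually_sequentially)
    then show ?thesis using WD K by blast
  qed
  have "\<exists>W. open W \<and> good W \<and> x \<in> W" for x
  proof -
    obtain W1 K N1 where 1: "open W1" "x \<in> W1" "K \<in> fmeasurable right_haar"
      "\<forall>u\<in>W1. u \<otimes> g \<in> K \<and> (\<forall>n\<ge>N1. u \<otimes> k n \<in> K)" by (use nbhd [OF k, of x] in auto)
    obtain W2 L N2 where 2: "open W2" "x \<in> W2" "L \<in> fmeasurable right_haar"
      "\<forall>u\<in>W2. u \<otimes> h \<in> L \<and> (\<forall>n\<ge>N2. u \<otimes> l n \<in> L)" by (use nbhd [OF l, of x] in auto)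
    have "good (W1 \<inter> W2)"
      unfolding good_def using 1 2
      by (intro conjI exI [of _ K] exI [of _ L] exI [of _ "max N1 N2"]) auto
    then show ?thesis using 1 2 by (intro exI [of _ "W1 \<inter> W2"]) auto
  qed
  then have cover: "\<Union>{W. open W \<and> good W} = UNIV" by auto
  obtain F where F: "F \<subseteq> {W. open W \<and> good W}" "countable F" "\<Union>F = \<Union>{W. open W \<and> good W}"
    by (rule Lindelof [of "{W. open W \<and> good W}"]) auto
  have "AE u in \<mu>. u \<notin> B \<inter> W" if W: "open W" and "good W" for W
  proof -
    obtain K L N where K: "K \<in> fmeasurable right_haar" and L: "L \<in> fmeasurable right_haar"
      and all: "\<forall>u\<in>W. u \<otimes> g \<in> K \<and> u \<otimes> h \<in> L \<and> (\<forall>n\<ge>N. u \<otimes> k n \<in> K \<and> u \<otimes> l n \<in> L)"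
      using \<open>good W\<close> unfolding good_def by metis
    have KL: "u \<otimes> g \<in> K" "u \<otimes> h \<in> L"
      "n \<ge> N \<Longrightarrow> u \<otimes> k n \<in> K" "n \<ge> N \<Longrightarrow> u \<otimes> l n \<in> L" if "u \<in> W" for u n
      using all that by simp_all
    have W_meas [measurable]: "W \<in> sets borel" using W by simp
    have [measurable]: "K \<in> sets borel" using K by (auto simp: fmeasurable_def)
    have Wf: "W \<in> fmeasurable right_haar"
      using KL by (intro fmeasurableI2 [OF vimage_fmeasurable(1) [OF K, of g]]) auto
    \<comment> \<open>\<open>S n\<close> and \<open>T n\<close> collect the points of
      \<open>W\<close> for which membership of a translate changes; the rest of
      \<open>B \<inter> W\<close> lies in the null set \<open>U n\<close>. The shift by
      \<open>N\<close> skips the terms whose translates may leave \<open>K\<close> or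
      \<open>L\<close>.\<close>
    define S T U where "S n = {u \<in> W. (u \<otimes> g \<in> Q) \<noteq> (u \<otimes> k (n + N) \<in> Q)}"
      and "T n = {u \<in> W. (u \<otimes> h \<in> R) \<noteq> (u \<otimes> l (n + N) \<in> R)}"
      and "U n = {u. u \<in> P \<and> u \<otimes> k (n + N) \<in> Q \<and> u \<otimes> l (n + N) \<in> R}" for n
    have [measurable]: "S n \<in> sets borel" "T n \<in> sets borel" "U n \<in> sets borel" for n
      unfolding S_def T_def U_def by measurable
    have "(\<lambda>n. measure right_haar (S n)) \<longlonglongrightarrow> 0"
      unfolding S_def using K KL k
      by (intro measure_translate_tendsto [where K = K]) (auto intro: LIMSEQ_ignore_initial_segment)
    moreover have "(\<lambda>n. measure right_haar (T n)) \<longlonglongrightarrow> 0"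
      unfolding T_def using L KL l
      by (intro measure_translate_tendsto [where K = L]) (auto intro: LIMSEQ_ignore_initial_segment)
    ultimately have "(\<lambda>n. measure right_haar (S n) + measure right_haar (T n)) \<longlonglongrightarrow> 0"
      using tendsto_add_zero by blast
    moreover have "measure right_haar (B \<inter> W) \<le> measure right_haar (S n) + measure right_haar (T n)" for n
    proof -
      have fin: "S n \<in> fmeasurable right_haar" "T n \<in> fmeasurable right_haar"
        by (auto intro!: fmeasurableI2 [OF Wf] simp: S_def T_def)
      have "AE u in \<mu>. u \<notin> U n" using null [of "n + N"] by (simp add: U_def)
      then have "emeasure \<mu> (U n) = 0" by (subst (asm) AE_iff_null_sets [symmetric]) auto
      then have U0: "emeasure right_haar (U n) = 0" by (simp add: null_right_haar_iff)
      then have Uf: "U n \<in> fmeasurable right_haar" by (auto simp: fmeasurable_def)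
      have "B \<inter> W \<subseteq> (S n \<union> T n) \<union> U n"
        by (auto simp: B_def S_def T_def U_def)
      then have "measure right_haar (B \<inter> W) \<le> measure right_haar ((S n \<union> T n) \<union> U n)"
        using fin Uf by (intro measure_mono_fmeasurable) (auto intro!: fmeasurable.Un)
      also have "\<dots> \<le> measure right_haar (S n \<union> T n) + measure right_haar (U n)"
        by (intro measure_Un_le) auto
      also have "measure right_haar (S n \<union> T n) \<le> measure right_haar (S n) + measure right_haar (T n)"
        by (intro measure_Un_le) auto
      finally show ?thesis using U0 by (simp add: measure_def)
    qed
    ultimately have "measure right_haar (B \<inter> W) \<le> 0"
      by (intro LIMSEQ_le_const) auto
    moreover have "B \<inter> W \<in> fmeasurable right_haar"
      by (intro fmeasurableI2 [OF Wf]) auto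
    ultimately have "emeasure right_haar (B \<inter> W) = 0"
      using measure_nonneg [of right_haar "B \<inter> W"] by (simp add: emeasure_eq_measure2 fmeasurableD2)
    then show ?thesis
      by (intro AE_not_in) (auto simp: null_right_haar_iff null_sets_def)
  qed
  then have "AE u in \<mu>. \<forall>W\<in>F. u \<notin> B \<inter> W"
    using F by (subst AE_ball_countable) auto
  then show ?thesis
    using F(3) cover by (auto simp: B_def elim!: eventually_mono)
qed

end

section \<open>Sets without returns along one-parameter subgroups\<close>

context haar_group begin

text \<open>By \<open>Int_meas_eq\<close> and \<open>spt_meas_eq\<close> this set expresses both the
  measure-theoretic interior and the support. In this form it is visibly unchanged when
  \<open>E\<close> is modified on a null set, so that \<open>E\<close> may be replaced by a Borel
  set.\<close>

definition ae_interior :: "'g set \<Rightarrow> 'g set" where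
  "ae_interior E = {x. \<exists>U. open U \<and> x \<in> U \<and> (AE u in \<mu>. u \<in> U \<longrightarrow> u \<in> E)}"

lemma ae_interiorE:
  assumes "x \<in> ae_interior E"
  obtains U where "open U" "x \<in> U" "AE u in \<mu>. u \<in> U \<longrightarrow> u \<in> E"
  using assms by (auto simp: ae_interior_def)

lemma ae_interiorI:
  "open U \<Longrightarrow> x \<in> U \<Longrightarrow> (AE u in \<mu>. u \<in> U \<longrightarrow> u \<in> E) \<Longrightarrow> x \<in> ae_interior E"
  by (auto simp: ae_interior_def)

lemma ae_interior_cong:
  assumes "AE u in \<mu>. u \<in> E \<longleftrightarrow> u \<in> F"
  shows "ae_interior E = ae_interior F"
proof -
  have "(AE u in \<mu>. u \<in> U \<longrightarrow> u \<in> E) \<longleftrightarrow> (AE u in \<mu>. u \<in> U \<longrightarrow> u \<in> F)" for U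
    using assms by (intro iffI) (auto elim!: eventually_elim2)
  then show ?thesis by (simp add: ae_interior_def)
qed

lemma spt_meas_eq:
  assumes "E \<in> sets (completion \<mu>)"
  shows "spt_meas \<mu> E = - ae_interior (- E)"
proof -
  have "emeasure (completion \<mu>) (E \<inter> U) = 0 \<longleftrightarrow> (AE u in \<mu>. u \<in> U \<longrightarrow> u \<in> - E)" if "open U" for U
  proof -
    have "U \<in> sets \<mu>" using that by simp
    then have "U \<in> sets (completion \<mu>)" by (rule sets_completionI_sets)
    with assms have "E \<inter> U \<in> sets (completion \<mu>)" by (rule sets.Int)
    then have "emeasure (completion \<mu>) (E \<inter> U) = 0 \<longleftrightarrow> E \<inter> U \<in> null_sets (completion \<mu>)"
      by (auto simp: null_sets_def)
    also have "\<dots> \<longleftrightarrow> (AE u in completion \<mu>. u \<notin> E \<inter> U)"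
      using \<open>E \<inter> U \<in> sets (completion \<mu>)\<close> by (rule AE_iff_null_sets)
    also have "\<dots> \<longleftrightarrow> (AE u in \<mu>. u \<in> U \<longrightarrow> u \<in> - E)"
      by (subst AE_completion_iff) (auto intro!: arg_cong [of _ _ "almost_everywhere \<mu>"])
    finally show ?thesis .
  qed
  then show ?thesis
    by (auto simp: spt_meas_def ae_interior_def zero_less_iff_neq_zero)
qed

lemma Int_meas_eq:
  assumes "E \<in> sets (completion \<mu>)"
  shows "Int_meas \<mu> E = ae_interior E"
proof -
  have "- E \<in> sets (completion \<mu>)"
    using sets.compl_sets [OF assms] by (simp add: Compl_eq_Diff_UNIV)
  then show ?thesis by (simp add: Int_meas_def spt_meas_eq)
qed

end

text \<open>\<open>e\<close> stands for the exponential map on the first layer in coordinates. The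
  argument uses its continuity, its additivity along each line through 0, and the openness expressed
  by \<open>open_at\<close>.\<close>

locale one_parameter = haar_group G \<mu>
  for G :: "'g::{t2_space,second_countable_topology} monoid" (structure) and \<mu> +
  fixes e :: "'m::euclidean_space \<Rightarrow> 'g"
  assumes continuous_e: "continuous_on UNIV e"
    and e_add: "e ((a + b) *\<^sub>R w) = e (a *\<^sub>R w) \<otimes> e (b *\<^sub>R w)"
begin

lemma e_0 [simp]: "e 0 = \<one>"
proof -
  have "e 0 \<otimes> e 0 = e 0" using e_add [of 0 0 0] by simp
  then show ?thesis by (metis inv_mult_cancel(1) l_inv mem_carrier)
qed

lemma mult_e_mult_e: "x \<otimes> e (a *\<^sub>R w) \<otimes> e (b *\<^sub>R w) = x \<otimes> e ((a + b) *\<^sub>R w)"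
  by (simp add: e_add m_assoc)

lemma tendsto_e [tendsto_intros]: "(f \<longlongrightarrow> a) F \<Longrightarrow> ((\<lambda>x. e (f x)) \<longlongrightarrow> e a) F"
  using continuous_e by (auto simp: continuous_on_eq_continuous_at intro: isCont_tendsto_compose)

lemma continuous_nbhd:
  assumes "open W" "x \<otimes> e (c *\<^sub>R w) \<in> W"
  obtains U D where "open U" "x \<in> U" "open D" "w \<in> D"
    "\<And>u v. u \<in> U \<Longrightarrow> v \<in> D \<Longrightarrow> u \<otimes> e (c *\<^sub>R v) \<in> W"
proof -
  have "((\<lambda>p. fst p \<otimes> e (c *\<^sub>R snd p)) \<longlongrightarrow> x \<otimes> e (c *\<^sub>R w)) (nhds (x, w))"
    by (intro tendsto_intros) (auto simp: nhds_prod intro: filterlim_fst filterlim_snd)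
  then have "eventually (\<lambda>p. fst p \<otimes> e (c *\<^sub>R snd p) \<in> W) (nhds (x, w))"
    using assms by (intro topological_tendstoD)
  then show ?thesis
    unfolding nhds_prod eventually_prod_filter eventually_nhds by (metis fst_conv snd_conv that)
qed

primrec e_prod :: "nat \<Rightarrow> (nat \<Rightarrow> 'm) \<Rightarrow> 'g" where
  "e_prod 0 Y = \<one>"
| "e_prod (Suc p) Y = e_prod p Y \<otimes> e (Y p)"

text \<open>This is openness of \<open>e_prod p\<close> at \<open>(w, ..., w)\<close>: by
  \<open>e_prod_const\<close> its value there is \<open>e (real p *\<^sub>R w)\<close>, and the
  powers of the neighbourhoods \<open>D\<close> of \<open>w\<close> form a base of neighbourhoods of
  that point.\<close>

definition open_at :: "nat \<Rightarrow> 'm \<Rightarrow> bool" where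
  "open_at p w \<longleftrightarrow> (\<forall>D. open D \<and> w \<in> D \<longrightarrow>
     (\<exists>T. open T \<and> e (real p *\<^sub>R w) \<in> T \<and> T \<subseteq> e_prod p ` {Y. \<forall>i<p. Y i \<in> D}))"

text \<open>Monotonicity in direction \<open>w\<close> without mention of lines: the pattern
  in-out-in has measure zero. Required of \<open>E\<close> and of \<open>- E\<close>, it excludes
  both non-monotone patterns. Fixing \<open>a\<close> and \<open>b\<close> before the null set is
  what lets the condition pass to limits in \<open>w\<close>.\<close>

definition no_return :: "'g set \<Rightarrow> 'm \<Rightarrow> bool" where
  "no_return E w \<longleftrightarrow> (\<forall>a b. 0 < a \<and> a < b \<longrightarrow>
     (AE u in \<mu>. \<not> (u \<in> E \<and> u \<otimes> e (a *\<^sub>R w) \<notin> E \<and> u \<otimes> e (b *\<^sub>R w) \<in> E)))"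

lemma no_returnD:
  assumes "no_return E w" "0 < a" "a < b"
  shows "AE u in \<mu>. \<not> (u \<in> E \<and> u \<otimes> e (a *\<^sub>R w) \<notin> E \<and> u \<otimes> e (b *\<^sub>R w) \<in> E)"
  using assms by (auto simp: no_return_def)

text \<open>Almost every point near the middle one has a point of \<open>E\<close> behind it at
  distance \<open>a\<close> and one ahead of it at distance \<open>b - a\<close>, so it cannot be
  outside \<open>E\<close>. The set \<open>?W\<close> pulls the two neighbourhoods back to the
  middle point.\<close>

lemma ae_interior_between:
  assumes E: "no_return E w" and ab: "0 < a" "a < b"
    and y: "y \<in> ae_interior E" "y \<otimes> e (b *\<^sub>R w) \<in> ae_interior E"
  shows "y \<otimes> e (a *\<^sub>R w) \<in> ae_interior E"
proof -
  obtain U where U: "open U" "y \<in> U" "AE u in \<mu>. u \<in> U \<longrightarrow> u \<in> E"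
    using y by (blast elim: ae_interiorE)
  obtain T where T: "open T" "y \<otimes> e (b *\<^sub>R w) \<in> T" "AE u in \<mu>. u \<in> T \<longrightarrow> u \<in> E"
    using y by (blast elim: ae_interiorE)
  let ?W = "{z. z \<otimes> e (- a *\<^sub>R w) \<in> U} \<inter> {z. z \<otimes> e ((b - a) *\<^sub>R w) \<in> T}"
  have "AE z in \<mu>. z \<in> ?W \<longrightarrow> z \<in> E"
    using AE_right [OF U(3), of "e (- a *\<^sub>R w)"] AE_right [OF T(3), of "e ((b - a) *\<^sub>R w)"]
      AE_right [OF no_returnD [OF E ab], of "e (- a *\<^sub>R w)"]
    unfolding mult_e_mult_e by eventually_elim auto
  moreover have "y \<otimes> e (a *\<^sub>R w) \<in> ?W"
    using U T unfolding mem_Collect_eq Int_iff mult_e_mult_e by simp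
  ultimately show ?thesis
    using U T by (intro ae_interiorI [of ?W] open_Int open_translate)
qed

text \<open>Almost every point near the last one has behind it first a point of \<open>E\<close> and
  then one of \<open>- E\<close>, so its membership in \<open>E\<close> would be a return.\<close>

lemma ae_interior_after:
  assumes E: "no_return E w" and ab: "0 < a" "a < b"
    and y: "y \<in> ae_interior E" "y \<otimes> e (a *\<^sub>R w) \<in> ae_interior (- E)"
  shows "y \<otimes> e (b *\<^sub>R w) \<in> ae_interior (- E)"
proof -
  obtain U where U: "open U" "y \<in> U" "AE u in \<mu>. u \<in> U \<longrightarrow> u \<in> E"
    using y by (blast elim: ae_interiorE)
  obtain T where T: "open T" "y \<otimes> e (a *\<^sub>R w) \<in> T" "AE u in \<mu>. u \<in> T \<longrightarrow> u \<in> - E"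
    using y by (blast elim: ae_interiorE)
  let ?W = "{z. z \<otimes> e (- b *\<^sub>R w) \<in> U} \<inter> {z. z \<otimes> e ((a - b) *\<^sub>R w) \<in> T}"
  have "AE z in \<mu>. z \<in> ?W \<longrightarrow> z \<in> - E"
    using AE_right [OF U(3), of "e (- b *\<^sub>R w)"] AE_right [OF T(3), of "e ((a - b) *\<^sub>R w)"]
      AE_right [OF no_returnD [OF E ab], of "e (- b *\<^sub>R w)"]
    unfolding mult_e_mult_e by eventually_elim (auto simp: algebra_simps)
  moreover have "y \<otimes> e (b *\<^sub>R w) \<in> ?W"
    using U T unfolding mem_Collect_eq Int_iff mult_e_mult_e by simp
  ultimately show ?thesis
    using U T by (intro ae_interiorI [of ?W] open_Int open_translate)
qed

text \<open>Suppose that the point reached after \<open>j\<close> steps is in \<open>E\<close>. Its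
  line in the next direction \<open>?v\<close> contains, at parameter \<open>- (real j + c)\<close>,
  a point of a region almost entirely outside \<open>E\<close>; as \<open>- E\<close> has no
  returns, the point at parameter 1 is in \<open>E\<close> again. \<open>W\<close> is arbitrary so
  that the induction hypothesis can keep the current point where the next step needs it.
  \<open>U\<close> and \<open>D\<close> serve all \<open>Y\<close> at once, whereas the null set may
  depend on \<open>Y\<close>.\<close>

lemma backward_chain:
  assumes E: "\<And>v. no_return (- E) v" and c: "0 < c"
    and T: "x \<otimes> e (c *\<^sub>R w) \<in> ae_interior (- E)"
    and W: "open W" "x \<otimes> e (real j *\<^sub>R (- w)) \<in> W"
  shows "\<exists>U D. open U \<and> x \<in> U \<and> open D \<and> - w \<in> D \<and> (\<forall>Y. (\<forall>i<j. Y i \<in> D) \<longrightarrow>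
    (\<forall>u\<in>U. u \<otimes> e_prod j Y \<in> W) \<and> (AE u in \<mu>. u \<in> U \<inter> E \<longrightarrow> u \<otimes> e_prod j Y \<in> E))"
  using W
proof (induction j arbitrary: W)
  case 0
  then show ?case
    by (intro exI [of _ W] exI [of _ UNIV]) auto
next
  case (Suc j)
  let ?x = "x \<otimes> e (real j *\<^sub>R (- w))"
  obtain Z where Z: "open Z" "x \<otimes> e (c *\<^sub>R w) \<in> Z" "AE u in \<mu>. u \<in> Z \<longrightarrow> u \<in> - E"
    using T by (rule ae_interiorE)
  have "?x \<otimes> e (1 *\<^sub>R (- w)) \<in> W"
    using Suc.prems unfolding mult_e_mult_e by (simp add: algebra_simps)
  from continuous_nbhd [OF Suc.prems(1) this] obtain U1 D1 where 1: "open U1" "?x \<in> U1" "open D1" "- w \<in> D1"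
    "\<And>u v. u \<in> U1 \<Longrightarrow> v \<in> D1 \<Longrightarrow> u \<otimes> e (1 *\<^sub>R v) \<in> W" by blast
  \<comment> \<open>From \<open>x\<close> moved \<open>j\<close> times by \<open>- w\<close>, a
    motion by \<open>real j + c\<close> in direction \<open>w\<close> leads to
    \<open>x \<otimes> e (c *\<^sub>R w)\<close>.\<close>
  have "?x \<otimes> e (- (real j + c) *\<^sub>R (- w)) \<in> Z"
    using Z unfolding mult_e_mult_e by simp
  from continuous_nbhd [OF Z(1) this] obtain U2 D2 where 2: "open U2" "?x \<in> U2" "open D2" "- w \<in> D2"
    "\<And>u v. u \<in> U2 \<Longrightarrow> v \<in> D2 \<Longrightarrow> u \<otimes> e (- (real j + c) *\<^sub>R v) \<in> Z" by blast
  obtain U D where UD: "open U" "x \<in> U" "open D" "- w \<in> D"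
    and Y: "\<And>Y. (\<forall>i<j. Y i \<in> D) \<Longrightarrow> (\<forall>u\<in>U. u \<otimes> e_prod j Y \<in> U1 \<inter> U2) \<and>
      (AE u in \<mu>. u \<in> U \<inter> E \<longrightarrow> u \<otimes> e_prod j Y \<in> E)"
    using Suc.IH [of "U1 \<inter> U2"] 1 2 by blast
  have "(\<forall>u\<in>U. u \<otimes> e_prod (Suc j) Y \<in> W) \<and> (AE u in \<mu>. u \<in> U \<inter> E \<longrightarrow> u \<otimes> e_prod (Suc j) Y \<in> E)"
    if YD: "\<forall>i<Suc j. Y i \<in> D \<inter> D1 \<inter> D2" for Y
  proof -
    let ?P = "e_prod j Y" and ?v = "Y j"
    have IH: "\<And>u. u \<in> U \<Longrightarrow> u \<otimes> ?P \<in> U1 \<and> u \<otimes> ?P \<in> U2" "AE u in \<mu>. u \<in> U \<inter> E \<longrightarrow> u \<otimes> ?P \<in> E"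
      using Y [of Y] YD by auto
    have v: "?v \<in> D1" "?v \<in> D2" using YD by auto
    \<comment> \<open>This is the condition for \<open>- E\<close> in direction \<open>- ?v\<close>
      with distances \<open>1\<close> and \<open>1 + real j + c\<close>, based at
      \<open>u \<otimes> e ?v\<close>; the second of the three points is then
      \<open>u\<close>.\<close>
    have nr: "AE u in \<mu>. \<not> (u \<otimes> e (1 *\<^sub>R ?v) \<notin> E \<and> u \<in> E \<and> u \<otimes> e (- (real j + c) *\<^sub>R ?v) \<notin> E)"
      using AE_right [OF no_returnD [OF E [of "- ?v"], of 1 "1 + real j + c"], of "e (1 *\<^sub>R ?v)"] c
      unfolding scaleR_minus_right scaleR_minus_left [symmetric] mult_e_mult_e by simp
    have "AE u in \<mu>. u \<in> U \<inter> E \<longrightarrow> u \<otimes> ?P \<otimes> e (1 *\<^sub>R ?v) \<in> E"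
      using AE_right [OF nr, of ?P] AE_right [OF AE_right [OF Z(3), of "e (- (real j + c) *\<^sub>R ?v)"], of ?P] IH(2)
    proof eventually_elim
      case (elim u)
      then show ?case using IH(1) [of u] 2(5) [OF _ v(2), of "u \<otimes> ?P"] by auto
    qed
    moreover have "\<forall>u\<in>U. u \<otimes> ?P \<otimes> e (1 *\<^sub>R ?v) \<in> W"
      using IH 1(5) v by blast
    ultimately show ?thesis by (simp add: m_assoc)
  qed
  then show ?case
    using UD 1 2 by (intro exI [of _ U] exI [of _ "D \<inter> D1 \<inter> D2"]) auto
qed

text \<open>For every \<open>g\<close> in the open set \<open>T\<close> given by
  \<open>open_at\<close>, the chain yields \<open>u \<otimes> g \<in> E\<close> for almost every
  \<open>u \<in> U \<inter> E\<close>. After an application of Fubini's theorem, some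
  \<open>u \<in> E\<close> near \<open>x\<close>, available because \<open>x\<close> is in the
  support of \<open>E\<close>, has \<open>u \<otimes> g \<in> E\<close> for almost every
  \<open>g \<in> T\<close>. The translate of \<open>T\<close> by \<open>u\<close> is the required
  neighbourhood.\<close>

lemma ae_interior_far_behind:
  assumes E [measurable]: "E \<in> sets borel" and nr: "\<And>v. no_return (- E) v" and c: "0 < c"
    and x: "x \<notin> ae_interior (- E)" and z: "x \<otimes> e (c *\<^sub>R w) \<in> ae_interior (- E)"
    and p: "open_at p (- w)"
  shows "x \<otimes> e (real p *\<^sub>R (- w)) \<in> ae_interior E"
proof -
  let ?q = "e (real p *\<^sub>R (- w))"
  obtain U D where U: "open U" "x \<in> U" and D: "open D" "- w \<in> D"
    and chain: "\<And>Y. (\<forall>i<p. Y i \<in> D) \<Longrightarrow> AE u in \<mu>. u \<in> U \<inter> E \<longrightarrow> u \<otimes> e_prod p Y \<in> E"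
    using backward_chain [OF nr c z open_UNIV UNIV_I, of p] by blast
  obtain T where T: "open T" "?q \<in> T" "T \<subseteq> e_prod p ` {Y. \<forall>i<p. Y i \<in> D}"
    using p D by (auto simp: open_at_def)
  have [measurable]: "U \<in> sets borel" "T \<in> sets borel" using U T by auto
  have "AE g in \<mu>. AE u in \<mu>. u \<in> U \<inter> E \<longrightarrow> g \<in> T \<longrightarrow> u \<otimes> g \<in> E"
  proof (rule AE_I2)
    fix g
    show "AE u in \<mu>. u \<in> U \<inter> E \<longrightarrow> g \<in> T \<longrightarrow> u \<otimes> g \<in> E"
    proof (cases "g \<in> T")
      case True
      then obtain Y where "g = e_prod p Y" "\<forall>i<p. Y i \<in> D" using T by blast
      then show ?thesis using chain [of Y] by (auto elim!: eventually_mono)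
    qed simp
  qed
  then have ae: "AE u in \<mu>. AE g in \<mu>. u \<in> U \<inter> E \<longrightarrow> g \<in> T \<longrightarrow> u \<otimes> g \<in> E"
    by (subst haar2.AE_commute) measurable
  \<comment> \<open>For \<open>u\<close> in this neighbourhood of \<open>x\<close> the translate of
    \<open>T\<close> by \<open>u\<close> contains \<open>x \<otimes> ?q\<close>.\<close>
  define U' where "U' = U \<inter> {u. inv u \<otimes> (x \<otimes> ?q) \<in> T}"
  have "open U'" "x \<in> U'"
    using U T by (auto simp: U'_def intro!: open_inv_translate)
  then have nx: "\<not> (AE u in \<mu>. u \<in> U' \<longrightarrow> u \<in> - E)"
    using x ae_interiorI by metis
  let ?R = "\<lambda>u. AE g in \<mu>. u \<in> U \<inter> E \<longrightarrow> g \<in> T \<longrightarrow> u \<otimes> g \<in> E"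
  have "\<exists>u. u \<in> U' \<and> u \<in> E \<and> ?R u"
  proof (rule ccontr)
    assume *: "\<nexists>u. u \<in> U' \<and> u \<in> E \<and> ?R u"
    have "u \<in> U' \<longrightarrow> u \<in> - E" if "?R u" for u
      using * that by blast
    with ae have "AE u in \<mu>. u \<in> U' \<longrightarrow> u \<in> - E"
      by (rule eventually_mono)
    with nx show False ..
  qed
  then obtain u where u: "u \<in> U'" "u \<in> E" and "?R u" by blast
  then have "AE g in \<mu>. g \<in> T \<longrightarrow> u \<otimes> g \<in> E" by (auto simp: U'_def)
  from AE_left [OF this, of "inv u"]
  have ae': "AE g in \<mu>. g \<in> {g. inv u \<otimes> g \<in> T} \<longrightarrow> g \<in> E"
    by simp
  have op: "open {g. inv u \<otimes> g \<in> T}"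
    using open_vimage [OF T(1) continuous_on_mult [OF continuous_on_const [of UNIV "inv u"] continuous_on_id]]
    by (simp add: vimage_def)
  show ?thesis
    using u by (intro ae_interiorI [OF op _ ae']) (simp add: U'_def)
qed

text \<open>Otherwise the line meets \<open>ae_interior E\<close> at parameter \<open>- p\<close>
  and \<open>ae_interior (- E)\<close> at parameter \<open>a\<close>, and
  \<open>ae_interior_after\<close> puts the point at parameter \<open>b\<close> into
  \<open>ae_interior (- E)\<close> too.\<close>

lemma not_ae_interior_between:
  assumes E: "E \<in> sets borel" and nr: "\<And>v. no_return E v" "\<And>v. no_return (- E) v"
    and p: "open_at p (- w)" and ab: "0 < a" "a < b"
    and y: "y \<notin> ae_interior (- E)" "y \<otimes> e (b *\<^sub>R w) \<notin> ae_interior (- E)"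
  shows "y \<otimes> e (a *\<^sub>R w) \<notin> ae_interior (- E)"
proof
  assume z: "y \<otimes> e (a *\<^sub>R w) \<in> ae_interior (- E)"
  let ?q = "y \<otimes> e (- real p *\<^sub>R w)"
  have "?q \<in> ae_interior E"
    using ae_interior_far_behind [OF E nr(2) ab(1) y(1) z p] by simp
  moreover have "?q \<otimes> e ((a + real p) *\<^sub>R w) \<in> ae_interior (- E)"
    using z unfolding mult_e_mult_e by simp
  ultimately have "?q \<otimes> e ((b + real p) *\<^sub>R w) \<in> ae_interior (- E)"
    using ab ae_interior_after [OF nr(1), of "a + real p" "b + real p" ?q w] by simp
  then show False
    using y unfolding mult_e_mult_e by simp
qed

text \<open>For fixed \<open>a\<close> and \<open>b\<close> the translating elements converge by
  continuity of \<open>e\<close>, so \<open>AE_translate_limit\<close> applies.\<close>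

lemma no_return_closed:
  assumes E [measurable]: "E \<in> sets borel" and dense: "w \<in> closure {v. no_return E v}"
  shows "no_return E w"
proof -
  obtain v where v: "\<And>n. no_return E (v n)" "v \<longlonglongrightarrow> w"
    using dense by (auto simp: closure_sequential)
  show ?thesis
    unfolding no_return_def
  proof (intro allI impI)
    fix a b :: real assume ab: "0 < a \<and> a < b"
    have "AE u in \<mu>. \<not> (u \<in> E \<and> u \<otimes> e (a *\<^sub>R w) \<in> - E \<and> u \<otimes> e (b *\<^sub>R w) \<in> E)"
    proof (rule AE_translate_limit)
      show "(\<lambda>n. e (a *\<^sub>R v n)) \<longlonglongrightarrow> e (a *\<^sub>R w)" "(\<lambda>n. e (b *\<^sub>R v n)) \<longlonglongrightarrow> e (b *\<^sub>R w)"
        using v by (auto intro!: tendsto_intros)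
      show "AE u in \<mu>. \<not> (u \<in> E \<and> u \<otimes> e (a *\<^sub>R v n) \<in> - E \<and> u \<otimes> e (b *\<^sub>R v n) \<in> E)" for n
        using no_returnD [OF v(1)] ab by simp
    qed auto
    then show "AE u in \<mu>. \<not> (u \<in> E \<and> u \<otimes> e (a *\<^sub>R w) \<notin> E \<and> u \<otimes> e (b *\<^sub>R w) \<in> E)"
      by simp
  qed
qed

end

section \<open>From almost every line to a dense set of directions\<close>

lemma AE_lborel_translate:
  assumes "AE t in lborel. P (t::real)"
  shows "AE t in lborel. P (t + a)"
proof -
  obtain N where N: "\<And>t. t \<in> space lborel - N \<Longrightarrow> P t" "N \<in> null_sets lborel"
    by (rule AE_E3 [OF assms]) blast
  have "AE t in lborel. t \<notin> N" using N by (intro AE_not_in)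
  moreover have [measurable]: "N \<in> sets borel" using N by auto
  ultimately have "AE t in lborel. a + 1 * t \<notin> N"
    by (intro AE_borel_affine) simp_all
  then show ?thesis
    using N(1) by (auto simp: add.commute elim!: eventually_mono)
qed

lemma monotone_indicator_no_return:
  fixes h :: "real \<Rightarrow> real"
  assumes h: "mono h \<or> antimono h" and ae: "AE t in lborel. indicator S t = h t"
    and ab: "0 < a" "a < b"
  shows "AE t in lborel. \<not> (t \<in> S \<and> t + a \<notin> S \<and> t + b \<in> S)"
    and "AE t in lborel. \<not> (t \<notin> S \<and> t + a \<in> S \<and> t + b \<notin> S)"
proof -
  have ae': "AE t in lborel. indicator S t = h t \<and> indicator S (t + a) = h (t + a) \<and> indicator S (t + b) = h (t + b)"
    using ae AE_lborel_translate [OF ae, of a] AE_lborel_translate [OF ae, of b]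
    by eventually_elim simp
  have mon: "(h t \<le> h (t + a) \<and> h (t + a) \<le> h (t + b)) \<or> (h t \<ge> h (t + a) \<and> h (t + a) \<ge> h (t + b))" for t
    using h ab by (auto simp: mono_def antimono_def)
  have *: "\<not> (t \<in> S \<and> t + a \<notin> S \<and> t + b \<in> S) \<and> \<not> (t \<notin> S \<and> t + a \<in> S \<and> t + b \<notin> S)"
    if "indicator S t = h t \<and> indicator S (t + a) = h (t + a) \<and> indicator S (t + b) = h (t + b)" for t
    using that mon [of t] by (cases "t \<in> S"; cases "t + a \<in> S"; cases "t + b \<in> S") auto
  show "AE t in lborel. \<not> (t \<in> S \<and> t + a \<notin> S \<and> t + b \<in> S)"
    and "AE t in lborel. \<not> (t \<notin> S \<and> t + a \<in> S \<and> t + b \<notin> S)"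
    using ae' by (eventually_elim, use * in blast)+
qed

text \<open>\<open>M\<close> will be the measure of a slice. It belongs to the outer variable of the
  iterated integral, so sigma-finiteness is required of \<open>lborel\<close> only.\<close>

lemma emeasure_distr_lborel_eq_0_iff:
  assumes [measurable]: "f \<in> measurable (M \<Otimes>\<^sub>M lborel) N" "B \<in> sets N"
  shows "emeasure (distr (M \<Otimes>\<^sub>M lborel) N f) B = 0 \<longleftrightarrow> (AE x in M. AE t in lborel. f (x, t) \<notin> B)"
proof -
  let ?C = "f -` B \<inter> space (M \<Otimes>\<^sub>M lborel)"
  have C [measurable]: "?C \<in> sets (M \<Otimes>\<^sub>M lborel)" by measurable
  have "emeasure (distr (M \<Otimes>\<^sub>M lborel) N f) B = (\<integral>\<^sup>+ x. \<integral>\<^sup>+ t. indicator ?C (x, t) \<partial>lborel \<partial>M)"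
    using lborel.emeasure_pair_measure [OF C] by (simp add: emeasure_distr)
  moreover have "(\<lambda>x. \<integral>\<^sup>+ t. indicator ?C (x, t) \<partial>lborel) \<in> borel_measurable M"
    by (intro lborel.borel_measurable_nn_integral_fst) measurable
  ultimately have "emeasure (distr (M \<Otimes>\<^sub>M lborel) N f) B = 0 \<longleftrightarrow>
      (AE x in M. (\<integral>\<^sup>+ t. indicator ?C (x, t) \<partial>lborel) = 0)"
    by (simp add: nn_integral_0_iff_AE)
  also have "\<dots> \<longleftrightarrow> (AE x in M. AE t in lborel. f (x, t) \<notin> B)"
  proof (rule AE_cong)
    fix x assume x: "x \<in> space M"
    have "(\<lambda>t. indicator ?C (x, t) :: ennreal) \<in> borel_measurable lborel"
      using x by measurable
    then have "(\<integral>\<^sup>+ t. indicator ?C (x, t) \<partial>lborel) = 0 \<longleftrightarrow> (AE t in lborel. indicator ?C (x, t) = (0::ennreal))"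
      by (rule nn_integral_0_iff_AE)
    also have "\<dots> \<longleftrightarrow> (AE t in lborel. f (x, t) \<notin> B)"
      using x by (intro AE_cong) (auto simp: indicator_def space_pair_measure)
    finally show "(\<integral>\<^sup>+ t. indicator ?C (x, t) \<partial>lborel) = 0 \<longleftrightarrow> (AE t in lborel. f (x, t) \<notin> B)" .
  qed
  finally show ?thesis .
qed

text \<open>By the definition of \<open>sphere_measure\<close>, the cone over the directions with
  \<open>f v \<noteq> 0\<close> has Lebesgue measure zero in the unit ball. If \<open>w\<close> were
  not in the closure, this cone would contain a ball.\<close>

lemma dense_if_AE_sphere:
  fixes f :: "'m::euclidean_space \<Rightarrow> ennreal" and w :: 'm
  assumes f: "f \<in> borel_measurable sphere_measure" and zero: "(\<integral>\<^sup>+ v. f v \<partial>sphere_measure) = 0"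
    and w: "w \<noteq> 0"
  shows "w \<in> closure {y. y \<noteq> 0 \<and> f (sgn y) = 0}"
proof -
  define C :: "'m set" where "C = cball 0 1 - {0}"
  define D where "D = distr (restrict_space lborel C) (restrict_space borel (sphere 0 1)) (sgn :: 'm \<Rightarrow> 'm)"
  have sm: "sphere_measure = scale_measure (of_nat DIM('m)) D"
    by (simp add: sphere_measure_def D_def C_def)
  have [measurable]: "C \<in> sets borel" by (simp add: C_def)
  have "(sgn :: 'm \<Rightarrow> 'm) \<in> borel_measurable borel"
    unfolding sgn_div_norm by measurable
  then have sgn: "sgn \<in> measurable (restrict_space lborel C) (restrict_space borel (sphere 0 1))"
    by (intro measurable_restrict_space2 measurable_restrict_space1)
       (auto simp: C_def space_restrict_space norm_sgn)
  define N where "N = {v \<in> space D. f v \<noteq> 0}"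
  have sets_eq: "sets sphere_measure = sets D" "space sphere_measure = space D"
    using sets_eq_imp_space_eq [of sphere_measure D] by (simp_all add: sm)
  have f': "f \<in> borel_measurable D" using f sets_eq by (simp add: measurable_def)
  then have N: "N \<in> sets D" unfolding N_def by measurable
  have "emeasure sphere_measure N = 0"
    using f zero by (simp add: nn_integral_0_iff N_def sets_eq)
  then have "emeasure D N = 0" by (simp add: sm)
  then have "emeasure (restrict_space lborel C) (sgn -` N \<inter> space (restrict_space lborel C)) = 0"
    using N by (simp add: D_def emeasure_distr [OF sgn])
  then have null: "emeasure lborel (sgn -` N \<inter> C) = 0"
    using measurable_sets [OF sgn, of N] N
    by (simp add: emeasure_restrict_space space_restrict_space D_def)
  \<comment> \<open>Norm 1/2 keeps the open ball of radius at most 1/2 around this point in the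
    punctured unit ball.\<close>
  define w' where "w' = (1 / (2 * norm w)) *\<^sub>R w"
  have nw': "norm w' = 1 / 2" using w by (simp add: w'_def)
  have "\<exists>y. y \<noteq> 0 \<and> f (sgn y) = 0 \<and> dist y w < \<epsilon>" if "\<epsilon> > 0" for \<epsilon> :: real
  proof (rule ccontr)
    assume no: "\<nexists>y. y \<noteq> 0 \<and> f (sgn y) = 0 \<and> dist y w < \<epsilon>"
    \<comment> \<open>The second bound makes multiplication by \<open>2 * norm w\<close>, which
      preserves \<open>sgn\<close>, map the ball around \<open>w'\<close> into the ball of radius
      \<open>\<epsilon>\<close> around \<open>w\<close>.\<close>
    define r where "r = min (1 / 2) (\<epsilon> / (2 * norm w))"
    have r: "0 < r" "r \<le> 1 / 2" "r \<le> \<epsilon> / (2 * norm w)" using that w by (auto simp: r_def)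
    have "ball w' r \<subseteq> sgn -` N \<inter> C"
    proof
      fix z assume z: "z \<in> ball w' r"
      then have d: "norm (z - w') < r" by (simp add: dist_norm norm_minus_commute)
      have "norm z \<le> norm (z - w') + norm w'" "norm w' \<le> norm (z - w') + norm z"
        using norm_triangle_sub [of z w'] norm_triangle_sub [of w' z]
        by (auto simp: norm_minus_commute)
      then have zC: "z \<in> C" using d r nw' by (auto simp: C_def)
      let ?y = "(2 * norm w) *\<^sub>R z"
      have "?y - w = (2 * norm w) *\<^sub>R (z - w')"
        using w by (simp add: w'_def algebra_simps)
      then have "dist ?y w = 2 * norm w * norm (z - w')"
        by (simp add: dist_norm)
      also have "\<dots> < 2 * norm w * (\<epsilon> / (2 * norm w))"
        using d r w by (intro mult_strict_left_mono) auto
      also have "\<dots> = \<epsilon>" using w by simp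
      finally have "f (sgn ?y) \<noteq> 0" using no zC w by (auto simp: C_def)
      moreover have "sgn ?y = sgn z"
        using w by (simp add: sgn_scaleR)
      ultimately show "z \<in> sgn -` N \<inter> C"
        using zC by (auto simp: N_def D_def space_restrict_space C_def norm_sgn)
    qed
    moreover have "sgn -` N \<inter> C \<in> sets lborel"
      using measurable_sets [OF sgn, of N] N
      by (auto simp: D_def space_restrict_space sets_restrict_space_iff)
    ultimately have "emeasure lborel (ball w' r) \<le> emeasure lborel (sgn -` N \<inter> C)"
      by (intro emeasure_mono)
    then have "ball w' r \<in> null_sets lborel"
      using null by (simp add: null_sets_def)
    then have "ball w' r \<in> null_sets lebesgue" by (rule null_sets_completionI)
    then show False
      using r open_not_negligible [of "ball w' r"] by (simp add: negligible_iff_null_sets)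
  qed
  then show ?thesis by (auto simp: closure_approachable)
qed

context one_parameter begin

lemma no_return_scale:
  assumes "no_return E v" "0 < c"
  shows "no_return E (c *\<^sub>R v)"
  unfolding no_return_def
proof (intro allI impI)
  fix a b :: real assume "0 < a \<and> a < b"
  then show "AE u in \<mu>. \<not> (u \<in> E \<and> u \<otimes> e (a *\<^sub>R c *\<^sub>R v) \<notin> E \<and> u \<otimes> e (b *\<^sub>R c *\<^sub>R v) \<in> E)"
    using no_returnD [OF assms(1), of "a * c" "b * c"] assms(2) by simp
qed

text \<open>By the normalization of the slice measure, a Borel set is null if and only if almost
  every line in direction \<open>v\<close> meets it for almost no parameter. This is applied to the
  set of points starting a forbidden pattern. \<open>F\<close> is the given set and \<open>E\<close>
  a Borel representative, to which monotonicity is transferred first.\<close>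

lemma no_return_slice:
  assumes E: "E \<in> sets borel" and EF: "AE u in \<mu>. u \<in> F \<longleftrightarrow> u \<in> E"
    and f: "(\<lambda>(x, t). x \<otimes> e (t *\<^sub>R v)) \<in> measurable (M \<Otimes>\<^sub>M lborel) \<mu>"
    and distr: "distr (M \<Otimes>\<^sub>M lborel) \<mu> (\<lambda>(x, t). x \<otimes> e (t *\<^sub>R v)) = \<mu>"
    and mon: "AE x in M. \<exists>h :: real \<Rightarrow> real. (mono h \<or> antimono h) \<and>
      (AE t in lborel. indicator F (x \<otimes> e (t *\<^sub>R v)) = h t)"
  shows "no_return E v" "no_return (- E) v"
proof -
  note [measurable] = E
  have iff: "emeasure \<mu> B = 0 \<longleftrightarrow> (AE x in M. AE t in lborel. x \<otimes> e (t *\<^sub>R v) \<notin> B)" if "B \<in> sets borel" for B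
    using emeasure_distr_lborel_eq_0_iff [OF f, of B] that distr by simp
  obtain N where N: "\<And>u. u \<in> space \<mu> - N \<Longrightarrow> u \<in> F \<longleftrightarrow> u \<in> E" "N \<in> null_sets \<mu>"
    by (rule AE_E3 [OF EF]) blast
  then have "AE x in M. AE t in lborel. x \<otimes> e (t *\<^sub>R v) \<notin> N"
    using iff [of N] by (auto simp: null_sets_def)
  with mon have mon': "AE x in M. \<exists>h :: real \<Rightarrow> real. (mono h \<or> antimono h) \<and>
      (AE t in lborel. indicator {t. x \<otimes> e (t *\<^sub>R v) \<in> E} t = h t)"
  proof eventually_elim
    case (elim x)
    then obtain h :: "real \<Rightarrow> real" where h: "mono h \<or> antimono h"
      and ae: "AE t in lborel. indicator F (x \<otimes> e (t *\<^sub>R v)) = h t" by (elim exE conjE)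
    from ae elim(2) have "AE t in lborel. indicator {t. x \<otimes> e (t *\<^sub>R v) \<in> E} t = h t"
    proof eventually_elim
      case (elim t)
      then show ?case using N(1) [of "x \<otimes> e (t *\<^sub>R v)"] by (simp add: indicator_def)
    qed
    with h show ?case by (intro exI conjI)
  qed
  have *: "AE x in M. (AE t in lborel. \<not> (x \<otimes> e (t *\<^sub>R v) \<in> E \<and> x \<otimes> e ((t + a) *\<^sub>R v) \<notin> E \<and> x \<otimes> e ((t + b) *\<^sub>R v) \<in> E))
    \<and> (AE t in lborel. \<not> (x \<otimes> e (t *\<^sub>R v) \<notin> E \<and> x \<otimes> e ((t + a) *\<^sub>R v) \<in> E \<and> x \<otimes> e ((t + b) *\<^sub>R v) \<notin> E))"
    if ab: "0 < a" "a < b" for a b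
    using mon'
  proof eventually_elim
    case (elim x)
    then obtain h :: "real \<Rightarrow> real" where h: "mono h \<or> antimono h"
      and ae: "AE t in lborel. indicator {t. x \<otimes> e (t *\<^sub>R v) \<in> E} t = h t" by (elim exE conjE)
    show ?case
      using monotone_indicator_no_return [OF h ae ab] by simp
  qed
  have null: "(AE u in \<mu>. u \<notin> B)" if "B \<in> sets borel" "emeasure \<mu> B = 0" for B
    using that by (intro AE_not_in) (auto simp: null_sets_def)
  have "AE u in \<mu>. \<not> (u \<in> E \<and> u \<otimes> e (a *\<^sub>R v) \<notin> E \<and> u \<otimes> e (b *\<^sub>R v) \<in> E)"
    if ab: "0 < a" "a < b" for a b
  proof -
    let ?B = "{u. u \<in> E \<and> u \<otimes> e (a *\<^sub>R v) \<notin> E \<and> u \<otimes> e (b *\<^sub>R v) \<in> E}"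
    have B: "?B \<in> sets borel" by measurable
    moreover have "emeasure \<mu> ?B = 0"
      unfolding iff [OF B] using * [OF ab] by (auto simp: mult_e_mult_e elim: eventually_mono)
    ultimately have "AE u in \<mu>. u \<notin> ?B" by (rule null)
    then show ?thesis by simp
  qed
  then show "no_return E v" by (simp add: no_return_def)
  have "AE u in \<mu>. \<not> (u \<notin> E \<and> u \<otimes> e (a *\<^sub>R v) \<in> E \<and> u \<otimes> e (b *\<^sub>R v) \<notin> E)"
    if ab: "0 < a" "a < b" for a b
  proof -
    let ?B = "{u. u \<notin> E \<and> u \<otimes> e (a *\<^sub>R v) \<in> E \<and> u \<otimes> e (b *\<^sub>R v) \<notin> E}"
    have B: "?B \<in> sets borel" by measurable
    moreover have "emeasure \<mu> ?B = 0"
      unfolding iff [OF B] using * [OF ab] by (auto simp: mult_e_mult_e elim: eventually_mono)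
    ultimately have "AE u in \<mu>. u \<notin> ?B" by (rule null)
    then show ?thesis by simp
  qed
  then show "no_return (- E) v" by (simp add: no_return_def)
qed

end

section \<open>Ordinary differential equations depending on a parameter\<close>

text \<open>\<open>Ck_on\<close> controls directional derivatives one at a time, so the operator
  norm is bounded by the sum of the bounds for the basis vectors. The mean value inequality on the
  convex ball then gives the Lipschitz estimate.\<close>

lemma C1_Lipschitz_bound:
  fixes f :: "'a::euclidean_space \<Rightarrow> 'b::euclidean_space"
  assumes f: "Ck_on 1 S f" and S: "cball z r \<subseteq> S"
  shows "\<exists>L\<ge>0. (\<forall>x\<in>cball z r. norm (f x) \<le> L) \<and>
    (\<forall>x\<in>cball z r. \<forall>y\<in>cball z r. norm (f x - f y) \<le> L * norm (x - y))"
proof -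
  let ?D = "\<lambda>x. frechet_derivative f (at x)"
  have der: "(f has_derivative ?D x) (at x)" if "x \<in> cball z r" for x
    using f S that by (auto simp: frechet_derivative_works)
  have bd: "\<exists>M. \<forall>x\<in>cball z r. norm (g x) \<le> M" if "continuous_on (cball z r) g" for g :: "'a \<Rightarrow> 'b"
    using compact_imp_bounded [OF compact_continuous_image [OF that compact_cball]]
    by (auto simp: bounded_iff)
  have "continuous_on (cball z r) f"
    by (intro continuous_at_imp_continuous_on ballI has_derivative_continuous [OF der])
  from bd [OF this] obtain M where M: "\<And>x. x \<in> cball z r \<Longrightarrow> norm (f x) \<le> M"
    by blast
  have "\<exists>K. \<forall>x\<in>cball z r. norm (?D x b) \<le> K" for b
  proof -
    have "continuous_on (cball z r) (\<lambda>x. ?D x b)"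
      using f S by (auto intro: continuous_on_subset)
    then show ?thesis by (rule bd)
  qed
  then obtain K where K: "\<And>b x. x \<in> cball z r \<Longrightarrow> norm (?D x b) \<le> K b"
    by metis
  define L where "L = max 0 (max M (\<Sum>b\<in>Basis. K b))"
  have "onorm (?D x) \<le> L" if x: "x \<in> cball z r" for x
  proof -
    have "onorm (?D x) \<le> (\<Sum>b\<in>Basis. K b)"
    proof (rule onorm_bound)
      show "0 \<le> (\<Sum>b\<in>Basis. K b)"
        using K [OF x] by (intro sum_nonneg order_trans [OF norm_ge_zero])
      fix v
      have lin: "linear (?D x)"
        using der [OF x] by (rule has_derivative_linear)
      have "?D x v = ?D x (\<Sum>b\<in>Basis. (v \<bullet> b) *\<^sub>R b)"
        by (simp add: euclidean_representation)
      also have "\<dots> = (\<Sum>b\<in>Basis. (v \<bullet> b) *\<^sub>R ?D x b)"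
        using lin by (simp add: linear_sum linear_scale)
      also have "norm \<dots> \<le> (\<Sum>b\<in>Basis. norm v * K b)"
        using K [OF x] by (intro sum_norm_le) (auto intro!: mult_mono simp: Basis_le_norm)
      also have "\<dots> = (\<Sum>b\<in>Basis. K b) * norm v"
        by (simp add: sum_distrib_left mult.commute)
      finally show "norm (?D x v) \<le> (\<Sum>b\<in>Basis. K b) * norm v" .
    qed
    then show ?thesis by (simp add: L_def)
  qed
  then have "norm (f x - f y) \<le> L * norm (x - y)" if "x \<in> cball z r" "y \<in> cball z r" for x y
    using that der by (intro differentiable_bound [of "cball z r" f ?D])
      (auto intro: has_derivative_at_withinI)
  moreover have "norm (f x) \<le> L" if "x \<in> cball z r" for x
    using M [OF that] by (simp add: L_def)
  moreover have "0 \<le> L" by (simp add: L_def)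
  ultimately show ?thesis by (intro exI [of _ L] conjI ballI)
qed

text \<open>At a time where the distance of the two solutions is maximal, the mean value inequality
  bounds this distance by \<open>L * \<delta> < 1\<close> times itself.\<close>

lemma ode_unique_local:
  fixes y1 y2 :: "real \<Rightarrow> 'a::euclidean_space"
  assumes lip: "\<And>x y. x \<in> K \<Longrightarrow> y \<in> K \<Longrightarrow> norm (F x - F y) \<le> L * norm (x - y)"
    and y1: "\<And>t. t \<in> cball t0 \<delta> \<Longrightarrow> y1 t \<in> K \<and> (y1 has_vector_derivative F (y1 t)) (at t)"
    and y2: "\<And>t. t \<in> cball t0 \<delta> \<Longrightarrow> y2 t \<in> K \<and> (y2 has_vector_derivative F (y2 t)) (at t)"
    and eq: "y1 t0 = y2 t0" and \<delta>: "L * \<delta> < 1" "0 \<le> \<delta>" and L: "0 \<le> L" and t: "t \<in> cball t0 \<delta>"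
  shows "y1 t = y2 t"
proof -
  let ?I = "cball t0 \<delta>" and ?d = "\<lambda>t. y1 t - y2 t"
  have der: "(?d has_vector_derivative F (y1 t) - F (y2 t)) (at t)" if "t \<in> ?I" for t
    using y1 [OF that] y2 [OF that] by (auto intro: has_vector_derivative_diff)
  have "continuous_on ?I (\<lambda>t. norm (?d t))"
    by (intro continuous_on_norm continuous_at_imp_continuous_on ballI
        has_vector_derivative_continuous [OF der])
  then obtain s where s: "s \<in> ?I" "\<And>t. t \<in> ?I \<Longrightarrow> norm (?d t) \<le> norm (?d s)"
    using continuous_attains_sup [of ?I "\<lambda>t. norm (?d t)"] \<delta> by auto
  have "norm (?d s - ?d t0) \<le> (L * norm (?d s)) * norm (s - t0)"
  proof (rule differentiable_bound [of ?I])
    fix t assume t: "t \<in> ?I"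
    show "(?d has_derivative (\<lambda>h. h *\<^sub>R (F (y1 t) - F (y2 t)))) (at t within ?I)"
      using der [OF t] by (simp add: has_vector_derivative_def has_derivative_at_withinI)
    have "norm (F (y1 t) - F (y2 t)) \<le> L * norm (?d t)"
      using lip y1 [OF t] y2 [OF t] by blast
    also have "\<dots> \<le> L * norm (?d s)"
      using s(2) [OF t] L by (rule mult_left_mono)
    finally show "onorm (\<lambda>h. h *\<^sub>R (F (y1 t) - F (y2 t))) \<le> L * norm (?d s)"
      by (simp add: onorm_scaleR_left [OF bounded_linear_ident] onorm_id)
  qed (use s \<delta> in auto)
  also have "\<dots> \<le> (L * norm (?d s)) * \<delta>"
    using s L by (intro mult_left_mono) (auto simp: dist_norm norm_minus_commute)
  finally have "(1 - L * \<delta>) * norm (?d s) \<le> 0"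
    using eq by (simp add: algebra_simps)
  then have "norm (?d s) \<le> 0"
    using \<delta> by (simp add: mult_le_0_iff)
  with s(2) [OF t] show ?thesis by simp
qed

text \<open>The Picard iteration is run on functions of the parameter and the time simultaneously, so that
  the solution depends continuously on the parameter.\<close>

lemma picard:
  fixes F :: "'m::euclidean_space \<Rightarrow> 'a::euclidean_space \<Rightarrow> 'a" and x0 :: 'a
  assumes \<rho>: "0 \<le> \<rho>"
    and cont: "continuous_on (W \<times> cball x0 \<rho>) (\<lambda>(w, x). F w x)"
    and bound: "\<And>w x. w \<in> W \<Longrightarrow> x \<in> cball x0 \<rho> \<Longrightarrow> norm (F w x) \<le> \<rho> / 2"
    and lip: "\<And>w x y. w \<in> W \<Longrightarrow> x \<in> cball x0 \<rho> \<Longrightarrow> y \<in> cball x0 \<rho> \<Longrightarrow>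
      norm (F w x - F w y) \<le> norm (x - y) / 4"
  shows "\<exists>y. continuous_on (W \<times> {-2..2}) (\<lambda>(w, t). y w t) \<and>
    (\<forall>w\<in>W. y w 0 = x0 \<and> (\<forall>t\<in>{-2..2::real}. y w t \<in> cball x0 \<rho> \<and>
      (y w has_vector_derivative F w (y w t)) (at t within {-2..2})))"
proof -
  let ?J = "{-2..2::real}" and ?I = "cbox 0 (1::real)"
  \<comment> \<open>The Picard operator, with the integral from 0 to \<open>t\<close> rescaled to
    the fixed interval \<open>[0, 1]\<close>. This treats both signs of \<open>t\<close> alike and
    makes continuity in \<open>(w, t)\<close> that of an integral with parameters.\<close>
  define P where "P y = (\<lambda>(w, t::real). x0 + t *\<^sub>R integral ?I (\<lambda>s. F w (y (w, s * t))))"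
    for y :: "'m \<times> real \<Rightarrow> 'a"
  define good where "good y \<longleftrightarrow> continuous_on (W \<times> ?J) y \<and> (\<forall>p\<in>W \<times> ?J. y p \<in> cball x0 \<rho>)"
    for y :: "'m \<times> real \<Rightarrow> 'a"
  have scale: "s * t \<in> ?J" if "s \<in> ?I" "t \<in> ?J" for s t
  proof -
    have "\<bar>s * t\<bar> \<le> 1 * 2"
      unfolding abs_mult using that by (intro mult_mono) auto
    then show ?thesis by (auto simp: abs_le_iff)
  qed
  have cont': "continuous_on ((W \<times> ?J) \<times> ?I) (\<lambda>(p, s). F (fst p) (y (fst p, s * snd p)))" if "good y" for y
  proof -
    have y: "continuous_on (W \<times> ?J) y" and yb: "\<And>p. p \<in> W \<times> ?J \<Longrightarrow> y p \<in> cball x0 \<rho>"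
      using that by (auto simp: good_def)
    have "continuous_on ((W \<times> ?J) \<times> ?I) (\<lambda>q. y (fst (fst q), snd q * snd (fst q)))"
      by (rule continuous_on_compose2 [OF y]) (auto intro!: continuous_intros scale [unfolded cbox_interval])
    then have "continuous_on ((W \<times> ?J) \<times> ?I)
        (\<lambda>q. (\<lambda>(w, x). F w x) (fst (fst q), y (fst (fst q), snd q * snd (fst q))))"
      by (intro continuous_on_compose2 [OF cont])
        (auto intro!: continuous_intros yb [simplified] scale [unfolded cbox_interval, simplified])
    then show ?thesis by (simp add: case_prod_unfold)
  qed
  have intg: "(\<lambda>s. F w (y (w, s * t))) integrable_on ?I" if "good y" "w \<in> W" "t \<in> ?J" for y w t
  proof -
    have "continuous_on ?I (\<lambda>s. (\<lambda>(p, s). F (fst p) (y (fst p, s * snd p))) ((w, t), s))"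
      by (rule continuous_on_compose2 [OF cont' [OF that(1)]]) (use that in \<open>auto intro!: continuous_intros\<close>)
    then show ?thesis by (simp add: integrable_continuous_interval)
  qed
  have inb: "y (w, s * t) \<in> cball x0 \<rho>" if "good y" "w \<in> W" "t \<in> ?J" "s \<in> ?I" for y w s t
    using scale [OF that(4,3)] that(1,2) by (simp add: good_def)
  have P_good: "good (P y)" if y: "good y" for y
  proof -
    have "continuous_on (W \<times> ?J) (\<lambda>p. integral ?I (\<lambda>s. F (fst p) (y (fst p, s * snd p))))"
      using integral_continuous_on_param [OF cont' [OF y]] by simp
    then have "continuous_on (W \<times> ?J) (P y)"
      unfolding P_def case_prod_unfold by (intro continuous_intros)
    moreover have "P y (w, t) \<in> cball x0 \<rho>" if wt: "w \<in> W" "t \<in> ?J" for w t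
    proof -
      have "norm (integral ?I (\<lambda>s. F w (y (w, s * t)))) \<le> \<rho> / 2 * measure lborel ?I"
        by (rule has_integral_bound [OF _ integrable_integral [OF intg [OF y wt]]
              bound [OF wt(1) inb [OF y wt]]]) (use \<rho> in simp_all)
      then have "norm (t *\<^sub>R integral ?I (\<lambda>s. F w (y (w, s * t)))) \<le> 2 * (\<rho> / 2)"
        using wt unfolding norm_scaleR by (intro mult_mono) auto
      then show ?thesis by (simp add: P_def dist_norm)
    qed
    ultimately show ?thesis by (auto simp: good_def)
  qed
  \<comment> \<open>Times are at most 2 in absolute value and the Lipschitz constant is 1/4, whence
    the contraction factor 1/2.\<close>
  have P_lip: "norm (P y p - P z p) \<le> M / 2"
    if y: "good y" and z: "good z" and M: "\<And>p. p \<in> W \<times> ?J \<Longrightarrow> norm (y p - z p) \<le> M"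
      and p: "p \<in> W \<times> ?J" for y z p M
  proof -
    obtain w t where wt: "p = (w, t)" "w \<in> W" "t \<in> ?J" using p by auto
    have "0 \<le> M" using M [OF p] norm_ge_zero order_trans by blast
    have "norm (integral ?I (\<lambda>s. F w (y (w, s * t)) - F w (z (w, s * t)))) \<le> M / 4 * measure lborel ?I"
    proof (rule has_integral_bound)
      show "((\<lambda>s. F w (y (w, s * t)) - F w (z (w, s * t))) has_integral
          integral ?I (\<lambda>s. F w (y (w, s * t)) - F w (z (w, s * t)))) ?I"
        using intg [OF y wt(2,3)] intg [OF z wt(2,3)] by (intro integrable_integral integrable_diff)
      fix s assume s: "s \<in> ?I"
      have "norm (F w (y (w, s * t)) - F w (z (w, s * t))) \<le> norm (y (w, s * t) - z (w, s * t)) / 4"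
        by (intro lip wt inb y z s)
      also have "\<dots> \<le> M / 4"
        using M [of "(w, s * t)"] scale [OF s wt(3)] wt by auto
      finally show "norm (F w (y (w, s * t)) - F w (z (w, s * t))) \<le> M / 4" .
    qed (use \<open>0 \<le> M\<close> in auto)
    then have "norm (t *\<^sub>R integral ?I (\<lambda>s. F w (y (w, s * t)) - F w (z (w, s * t)))) \<le> 2 * (M / 4)"
      using wt unfolding norm_scaleR by (intro mult_mono) auto
    moreover have "P y p - P z p = t *\<^sub>R integral ?I (\<lambda>s. F w (y (w, s * t)) - F w (z (w, s * t)))"
      using intg [OF y wt(2,3)] intg [OF z wt(2,3)]
      by (simp add: P_def wt(1) integral_diff scaleR_diff_right)
    ultimately show ?thesis by simp
  qed
  define Y where "Y n = (P ^^ n) (\<lambda>_. x0)" for n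
  have Y_good: "good (Y n)" for n
  proof (induction n)
    case 0
    then show ?case using \<rho> by (auto simp: Y_def good_def)
  next
    case (Suc n)
    then show ?case using P_good by (simp add: Y_def)
  qed
  have Y_diff: "norm (Y (Suc n) p - Y n p) \<le> \<rho> * (1 / 2) ^ n" if "p \<in> W \<times> ?J" for n p
    using that
  proof (induction n arbitrary: p)
    case 0
    have "Y (Suc 0) p \<in> cball x0 \<rho>" using Y_good [of "Suc 0"] 0 by (auto simp: good_def)
    then show ?case by (simp add: Y_def dist_norm norm_minus_commute)
  next
    case (Suc n)
    have "norm (P (Y (Suc n)) p - P (Y n) p) \<le> (\<rho> * (1 / 2) ^ n) / 2"
      by (rule P_lip [OF Y_good Y_good Suc.IH Suc.prems])
    then show ?case by (simp add: Y_def)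
  qed
  \<comment> \<open>The iterates are the partial sums of a series dominated by a geometric one, so
    they converge uniformly in parameter and time together.\<close>
  have "uniform_limit (W \<times> ?J) (\<lambda>n p. \<Sum>i<n. Y (Suc i) p - Y i p)
      (\<lambda>p. \<Sum>i. Y (Suc i) p - Y i p) sequentially"
    by (rule Weierstrass_m_test [OF Y_diff]) (auto intro!: summable_mult summable_geometric)
  then have "uniform_limit (W \<times> ?J) (\<lambda>n p. x0 + (\<Sum>i<n. Y (Suc i) p - Y i p))
      (\<lambda>p. x0 + (\<Sum>i. Y (Suc i) p - Y i p)) sequentially"
    by (intro uniform_limit_intros)
  moreover have "x0 + (\<Sum>i<n. Y (Suc i) p - Y i p) = Y n p" for n p
    by (simp add: sum_lessThan_telescope [of "\<lambda>i. Y i p"]) (simp add: Y_def)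
  ultimately obtain y where y: "uniform_limit (W \<times> ?J) Y y sequentially"
    by auto
  have y_cont: "continuous_on (W \<times> ?J) y"
    using Y_good by (intro uniform_limit_theorem [OF _ y]) (auto simp: good_def)
  have "y p \<in> cball x0 \<rho>" if "p \<in> W \<times> ?J" for p
    using tendsto_uniform_limitI [OF y that] Y_good that
    by (intro Lim_in_closed_set [OF closed_cball]) (auto simp: good_def)
  then have y_good: "good y" using y_cont by (simp add: good_def)
  have fixp: "y p = P y p" if p: "p \<in> W \<times> ?J" for p
  proof -
    have lim: "(\<lambda>n. P (Y n) p) \<longlonglongrightarrow> P y p"
    proof (rule tendstoI)
      fix \<epsilon> :: real assume "\<epsilon> > 0"
      then have "eventually (\<lambda>n. \<forall>p\<in>W \<times> ?J. dist (Y n p) (y p) < \<epsilon>) sequentially"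
        using y by (auto simp: uniform_limit_iff)
      then show "eventually (\<lambda>n. dist (P (Y n) p) (P y p) < \<epsilon>) sequentially"
      proof eventually_elim
        case (elim n)
        then have "norm (P (Y n) p - P y p) \<le> \<epsilon> / 2"
          by (intro P_lip Y_good y_good p) (auto simp: dist_norm less_imp_le)
        then show ?case using \<open>\<epsilon> > 0\<close> by (simp add: dist_norm)
      qed
    qed
    have "(\<lambda>n. Y (Suc n) p) \<longlonglongrightarrow> y p"
      using tendsto_uniform_limitI [OF y p] by (rule LIMSEQ_Suc)
    then have "(\<lambda>n. P (Y n) p) \<longlonglongrightarrow> y p" by (simp add: Y_def)
    then show ?thesis using lim by (rule LIMSEQ_unique)
  qed
  have y_der: "((\<lambda>t. y (w, t)) has_vector_derivative F w (y (w, t))) (at t within ?J)"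
    if w: "w \<in> W" and t: "t \<in> ?J" for w t
  proof -
    let ?\<phi> = "\<lambda>t. F w (y (w, t))"
    have \<phi>: "continuous_on ?J ?\<phi>"
    proof -
      have "continuous_on ?J (\<lambda>t. y (w, t))"
        by (rule continuous_on_compose2 [OF y_cont]) (use w in \<open>auto intro!: continuous_intros\<close>)
      then have "continuous_on ?J (\<lambda>t. (\<lambda>(w, x). F w x) (w, y (w, t)))"
        using w y_good by (intro continuous_on_compose2 [OF cont]) (auto intro!: continuous_intros simp: good_def)
      then show ?thesis by simp
    qed
    \<comment> \<open>With the rescaling undone, the fixed point equation says that
      \<open>y (w, t)\<close> is \<open>x0 + (Q t - Q 0)\<close>. The base point \<open>-2\<close>
      makes \<open>Q\<close> a primitive on all of the interval.\<close>
    define Q where "Q t = integral {-2..t} ?\<phi>" for t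
    have Q: "(Q has_vector_derivative ?\<phi> t) (at t within ?J)" if "t \<in> ?J" for t
      unfolding Q_def by (rule integral_has_vector_derivative [OF \<phi> that])
    have eq: "y (w, t) = x0 + (Q t - Q 0)" if t: "t \<in> ?J" for t
    proof -
      have "((\<lambda>s. t *\<^sub>R ?\<phi> (s * t)) has_integral Q (1 * t) - Q (0 * t)) {0..1}"
      proof (rule fundamental_theorem_of_calculus)
        fix s :: real assume s: "s \<in> {0..1}"
        have "((\<lambda>s. s * t) has_vector_derivative t) (at s within {0..1})"
          by (auto intro!: derivative_eq_intros)
        moreover have "(Q has_vector_derivative ?\<phi> (s * t)) (at (s * t) within (\<lambda>s. s * t) ` {0..1})"
          using s t scale by (intro has_vector_derivative_within_subset [OF Q]) auto
        ultimately have "((Q \<circ> (\<lambda>s. s * t)) has_vector_derivative t *\<^sub>R ?\<phi> (s * t)) (at s within {0..1})"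
          by (intro vector_diff_chain_within)
        then show "((\<lambda>s. Q (s * t)) has_vector_derivative t *\<^sub>R ?\<phi> (s * t)) (at s within {0..1})"
          by (simp add: o_def)
      qed simp
      from integral_unique [OF this] have "t *\<^sub>R integral ?I (\<lambda>s. ?\<phi> (s * t)) = Q t - Q 0"
        by simp
      then show ?thesis
        using fixp [of "(w, t)"] w t by (simp add: P_def)
    qed
    have "((\<lambda>t. x0 + (Q t - Q 0)) has_vector_derivative ?\<phi> t) (at t within ?J)"
      using Q [OF t] by (auto intro!: derivative_eq_intros)
    then show ?thesis
      using t by (rule has_vector_derivative_transform [rotated 2]) (auto simp: eq)
  qed
  have y_cont': "continuous_on (W \<times> ?J) (\<lambda>(w, t). y (w, t))"
    using y_cont by (simp add: case_prod_unfold)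
  have y_in: "y (w, t) \<in> cball x0 \<rho>" if "w \<in> W" "t \<in> ?J" for w t
    using y_good that by (simp add: good_def)
  have y_0: "y (w, 0) = x0" if "w \<in> W" for w
    using fixp [of "(w, 0)"] that by (simp add: P_def)
  show ?thesis
    by (intro exI [of _ "\<lambda>w t. y (w, t)"] conjI ballI y_cont' y_in y_0 y_der)
qed

section \<open>The exponential map of a Lie group\<close>

lemma has_vector_derivative_cong_nhds:
  assumes "(f has_vector_derivative D) (at t)" "eventually (\<lambda>s. f s = g s) (nhds t)"
  shows "(g has_vector_derivative D) (at t)"
proof -
  obtain U where "open U" "t \<in> U" "\<And>s. s \<in> U \<Longrightarrow> f s = g s"
    using assms(2) by (auto simp: eventually_nhds)
  then show ?thesis
    by (rule has_vector_derivative_transform_within_open [OF assms(1)])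
qed

section \<open>Charts and the underlying topological group\<close>

locale chart_group =
  fixes G :: "'g::{t2_space,second_countable_topology} monoid" (structure)
    and A :: "('g, 'e::euclidean_space) chart set"
  assumes lie: "lie_group G A"
begin

lemma atlas: "smooth_atlas A"
  using lie by (simp add: lie_group_def)

lemma is_chartD:
  assumes "c \<in> A"
  shows "open (fst c)" "open (snd c ` fst c)" "continuous_on (fst c) (snd c)"
    "continuous_on (snd c ` fst c) (coords_inv c)" "inj_on (snd c) (fst c)"
    "p \<in> fst c \<Longrightarrow> coords_inv c (snd c p) = p"
    "x \<in> snd c ` fst c \<Longrightarrow> coords_inv c x \<in> fst c"
    "x \<in> snd c ` fst c \<Longrightarrow> snd c (coords_inv c x) = x"
proof -
  have c: "is_chart c" using assms atlas by (simp add: smooth_atlas_def)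
  then show "open (fst c)" "open (snd c ` fst c)" by (simp_all add: is_chart_def)
  have h: "homeomorphism (fst c) (snd c ` fst c) (snd c) (coords_inv c)"
    using c by (simp add: is_chart_def)
  then show "continuous_on (fst c) (snd c)" "continuous_on (snd c ` fst c) (coords_inv c)"
    by (simp_all add: homeomorphism_def)
  show inv: "p \<in> fst c \<Longrightarrow> coords_inv c (snd c p) = p" for p
    using h by (rule homeomorphism_apply1)
  show "inj_on (snd c) (fst c)"
    using inv by (rule inj_on_inverseI)
  show "x \<in> snd c ` fst c \<Longrightarrow> coords_inv c x \<in> fst c"
    by (rule inv_into_into)
  show "x \<in> snd c ` fst c \<Longrightarrow> snd c (coords_inv c x) = x"
    by (rule f_inv_into_f)
qed

lemma chart_at: obtains c where "c \<in> A" "p \<in> fst c"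
proof -
  have "p \<in> (\<Union>c\<in>A. fst c)" using atlas by (simp add: smooth_atlas_def)
  then show ?thesis using that by blast
qed

lemma eventually_in_chart:
  assumes "isCont \<gamma> t" "c \<in> A" "\<gamma> t \<in> fst c"
  shows "eventually (\<lambda>s. \<gamma> s \<in> fst c) (nhds t)"
proof -
  have "(\<gamma> \<longlongrightarrow> \<gamma> t) (nhds t)"
    using assms(1) by (simp add: tendsto_at_iff_tendsto_nhds isCont_def)
  then show ?thesis
    using assms is_chartD(1) by (intro topological_tendstoD)
qed

sublocale topological_group G
proof -
  interpret group G using lie by (simp add: lie_group_def)
  show "topological_group G"
  proof
    show "carrier G = UNIV" using lie by (simp add: lie_group_def)
    show "continuous_on UNIV (\<lambda>(x, y). x \<otimes> y)" "continuous_on UNIV (\<lambda>x. inv x)"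
      using lie by (simp_all add: lie_group_def smooth_map_def)
  qed
qed

lemma locally_compact_chart: "\<exists>U K. open U \<and> (p::'g) \<in> U \<and> U \<subseteq> K \<and> compact K"
proof -
  obtain c where c: "c \<in> A" "p \<in> fst c" by (rule chart_at)
  note C = is_chartD [OF c(1)]
  obtain r where r: "0 < r" "cball (snd c p) r \<subseteq> snd c ` fst c"
    using C(2) c(2) by (auto simp: open_contains_cball)
  let ?U = "fst c \<inter> snd c -` ball (snd c p) r" and ?K = "coords_inv c ` cball (snd c p) r"
  have "open ?U"
    using continuous_open_preimage [OF C(3,1)] by blast
  moreover have "p \<in> ?U" using c r by simp
  moreover have "?U \<subseteq> ?K"
  proof
    fix q assume "q \<in> ?U"
    then show "q \<in> ?K"
      using C(6) [of q] by (intro image_eqI [of _ _ "snd c q"]) auto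
  qed
  moreover have "compact ?K"
    using C(4) r(2) by (intro compact_continuous_image compact_cball) (rule continuous_on_subset)
  ultimately show ?thesis by blast
qed

text \<open>Smoothness of the multiplication is given in product charts; freezing the coordinates of
  \<open>a\<close> in the first variable gives differentiability. Only then is
  \<open>tangent_map\<close>, defined through \<open>frechet_derivative\<close>, an actual
  derivative.\<close>

lemma left_translation_derivative:
  assumes c: "c \<in> A" and d: "d \<in> A" and p: "p \<in> fst c" and ap: "a \<otimes> p \<in> fst d"
  shows "((snd d \<circ> (\<lambda>q. a \<otimes> q) \<circ> coords_inv c) has_derivative tangent_map (\<lambda>q. a \<otimes> q) c d p) (at (snd c p))"
proof -
  obtain b where b: "b \<in> A" "a \<in> fst b" by (rule chart_at)
  define bc where "bc = (fst b \<times> fst c, map_prod (snd b) (snd c))"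
  have bc: "bc \<in> prod_atlas A A" using b c unfolding bc_def prod_atlas_def by blast
  let ?F = "\<lambda>(x, y). x \<otimes> y" and ?z = "(snd b a, snd c p)"
  let ?\<Phi> = "snd d \<circ> ?F \<circ> coords_inv bc"
  have "smooth_map (prod_atlas A A) A ?F" using lie by (simp add: lie_group_def)
  then have "smooth_on (snd bc ` (fst bc \<inter> ?F -` fst d)) ?\<Phi>"
    using bc d unfolding smooth_map_def by blast
  then have "Ck_on (Suc 0) (snd bc ` (fst bc \<inter> ?F -` fst d)) ?\<Phi>"
    unfolding smooth_on_def by blast
  moreover have "?z \<in> snd bc ` (fst bc \<inter> ?F -` fst d)"
    using b p ap by (intro image_eqI [of _ _ "(a, p)"]) (auto simp: bc_def)
  ultimately have "?\<Phi> differentiable at ?z" unfolding Ck_on.simps by blast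
  moreover have "(\<lambda>x. (snd b a, x)) differentiable at (snd c p)"
    by (intro differentiableI [of _ "\<lambda>h. (0, h)"]) (auto intro!: derivative_eq_intros)
  ultimately have "(?\<Phi> \<circ> (\<lambda>x. (snd b a, x))) differentiable at (snd c p)"
    by (intro differentiable_chain_at)
  then obtain D where D: "((?\<Phi> \<circ> (\<lambda>x. (snd b a, x))) has_derivative D) (at (snd c p))"
    unfolding differentiable_def by blast
  have inj: "inj_on (map_prod (snd b) (snd c)) (fst b \<times> fst c)"
    using map_prod_inj_on [OF is_chartD(5) [OF b(1)] is_chartD(5) [OF c]] .
  have "((snd d \<circ> (\<lambda>q. a \<otimes> q) \<circ> coords_inv c) has_derivative D) (at (snd c p))"
  proof (rule has_derivative_transform_within_open [OF D is_chartD(2) [OF c]])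
    show "snd c p \<in> snd c ` fst c" using p by simp
    fix x assume "x \<in> snd c ` fst c"
    then obtain q where q: "q \<in> fst c" "x = snd c q" by auto
    have "coords_inv bc (snd b a, snd c q) = (a, q)"
      using inv_into_f_f [OF inj, of "(a, q)"] b q by (simp add: bc_def)
    then show "(?\<Phi> \<circ> (\<lambda>x. (snd b a, x))) x = (snd d \<circ> (\<lambda>q. a \<otimes> q) \<circ> coords_inv c) x"
      using is_chartD(6) [OF c q(1)] q by simp
  qed
  then have "(snd d \<circ> (\<lambda>q. a \<otimes> q) \<circ> coords_inv c) differentiable at (snd c p)"
    by (rule differentiableI)
  then show ?thesis
    unfolding tangent_map_def by (simp only: frechet_derivative_works)
qed

text \<open>The condition for an integral curve at a single time, which also makes sense for curves
  on an interval and for curves glued from pieces.\<close>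

definition velocity :: "('g, 'e) vfield \<Rightarrow> (real \<Rightarrow> 'g) \<Rightarrow> real \<Rightarrow> bool" where
  "velocity X \<gamma> t \<longleftrightarrow> isCont \<gamma> t \<and>
     (\<forall>c\<in>A. \<gamma> t \<in> fst c \<longrightarrow> (snd c \<circ> \<gamma> has_vector_derivative X c (\<gamma> t)) (at t))"

lemma integral_curve_iff: "integral_curve A X \<gamma> \<longleftrightarrow> (\<forall>t. velocity X \<gamma> t)"
  by (auto simp: integral_curve_def velocity_def continuous_on_eq_continuous_at)

text \<open>This is the chain rule combined with left invariance. The derivative is assumed in one
  chart and obtained in every chart at the translated point, so \<open>a = \<one>\<close> gives
  independence of the chart in \<open>velocity_chart\<close>.\<close>

lemma velocity_translate_chart:
  assumes X: "X \<in> lie_algebra G A" and c: "c \<in> A" "\<gamma> t \<in> fst c" and cont: "isCont \<gamma> t"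
    and der: "(snd c \<circ> \<gamma> has_vector_derivative X c (\<gamma> t)) (at t)"
  shows "velocity X (\<lambda>s. a \<otimes> \<gamma> s) t"
  unfolding velocity_def
proof (intro conjI ballI impI)
  show "isCont (\<lambda>s. a \<otimes> \<gamma> s) t"
    using cont by (simp add: isCont_def tendsto_mult)
  fix d assume d: "d \<in> A" "a \<otimes> \<gamma> t \<in> fst d"
  let ?T = "snd d \<circ> (\<lambda>q. a \<otimes> q) \<circ> coords_inv c"
  have "((?T \<circ> (snd c \<circ> \<gamma>)) has_derivative
      tangent_map (\<lambda>q. a \<otimes> q) c d (\<gamma> t) \<circ> (\<lambda>h. h *\<^sub>R X c (\<gamma> t))) (at t)"
    using left_translation_derivative [OF c(1) d(1) c(2) d(2)] der
    by (intro diff_chain_at) (simp_all add: has_vector_derivative_def)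
  moreover have "tangent_map (\<lambda>q. a \<otimes> q) c d (\<gamma> t) \<circ> (\<lambda>h. h *\<^sub>R X c (\<gamma> t)) =
      (\<lambda>h. h *\<^sub>R X d (a \<otimes> \<gamma> t))"
  proof -
    have "X d (a \<otimes> \<gamma> t) = tangent_map (\<lambda>q. a \<otimes> q) c d (\<gamma> t) (X c (\<gamma> t))"
      using X c d by (auto simp: lie_algebra_def)
    then show ?thesis
      using linear_scale [OF has_derivative_linear [OF left_translation_derivative [OF c(1) d(1) c(2) d(2)]]]
      by (simp add: fun_eq_iff)
  qed
  ultimately have "((?T \<circ> (snd c \<circ> \<gamma>)) has_vector_derivative X d (a \<otimes> \<gamma> t)) (at t)"
    by (simp add: has_vector_derivative_def)
  moreover have "eventually (\<lambda>s. (?T \<circ> (snd c \<circ> \<gamma>)) s = (snd d \<circ> (\<lambda>s. a \<otimes> \<gamma> s)) s) (nhds t)"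
    using eventually_in_chart [OF cont c] by eventually_elim (simp add: is_chartD(6) [OF c(1)])
  ultimately show "(snd d \<circ> (\<lambda>s. a \<otimes> \<gamma> s) has_vector_derivative X d (a \<otimes> \<gamma> t)) (at t)"
    by (rule has_vector_derivative_cong_nhds)
qed

lemma velocity_translate:
  assumes X: "X \<in> lie_algebra G A" and v: "velocity X \<gamma> t"
  shows "velocity X (\<lambda>s. a \<otimes> \<gamma> s) t"
proof -
  obtain c where "c \<in> A" "\<gamma> t \<in> fst c" by (rule chart_at)
  then show ?thesis
    using v by (intro velocity_translate_chart [OF X]) (auto simp: velocity_def)
qed

lemma velocity_chart:
  assumes X: "X \<in> lie_algebra G A" and "c \<in> A" "\<gamma> t \<in> fst c" "isCont \<gamma> t"
    "(snd c \<circ> \<gamma> has_vector_derivative X c (\<gamma> t)) (at t)"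
  shows "velocity X \<gamma> t"
  using velocity_translate_chart [OF assms, of \<one>] by simp

lemma velocity_affine:
  assumes v: "velocity X \<gamma> (r * t + b)"
  shows "velocity (r *\<^sub>R X) (\<lambda>t. \<gamma> (r * t + b)) t"
  unfolding velocity_def
proof (intro conjI ballI impI)
  have aff: "((\<lambda>t. r * t + b) has_vector_derivative r) (at t)"
    by (auto intro!: derivative_eq_intros)
  have "isCont (\<lambda>t. r * t + b) t" by (intro continuous_intros)
  then show "isCont (\<lambda>t. \<gamma> (r * t + b)) t"
    by (rule isCont_o2 [where g = \<gamma>]) (use v in \<open>simp add: velocity_def\<close>)
  fix c assume "c \<in> A" "\<gamma> (r * t + b) \<in> fst c"
  then have "(snd c \<circ> \<gamma> has_vector_derivative X c (\<gamma> (r * t + b))) (at (r * t + b))"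
    using v by (simp add: velocity_def)
  from vector_diff_chain_at [OF aff this]
  show "(snd c \<circ> (\<lambda>t. \<gamma> (r * t + b)) has_vector_derivative (r *\<^sub>R X) c (\<gamma> (r * t + b))) (at t)"
    by (simp add: o_def scaleR_fun_def)
qed

lemma velocity_cong:
  assumes "velocity X \<gamma> t" "eventually (\<lambda>s. \<gamma> s = \<beta> s) (nhds t)"
  shows "velocity X \<beta> t"
proof -
  have eq: "\<gamma> t = \<beta> t" using assms(2) by (rule eventually_nhds_x_imp_x)
  have "isCont \<beta> t" using assms isCont_cong [of \<gamma> \<beta> t] by (simp add: velocity_def)
  moreover have "(snd c \<circ> \<beta> has_vector_derivative D) (at t)"
    if "(snd c \<circ> \<gamma> has_vector_derivative D) (at t)" for c :: "('g, 'e) chart" and D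
    by (rule has_vector_derivative_cong_nhds [OF that], rule eventually_mono [OF assms(2)]) simp
  ultimately show ?thesis using assms(1) eq by (simp add: velocity_def)
qed

section \<open>Uniqueness of integral curves\<close>

lemma lie_algebra_C1:
  assumes "X \<in> lie_algebra G A" "c \<in> A"
  shows "Ck_on 1 (snd c ` fst c) (X c \<circ> coords_inv c)"
proof -
  have "smooth_on (snd c ` fst c) (X c \<circ> coords_inv c)"
    using assms unfolding lie_algebra_def vector_field_def by blast
  then show ?thesis unfolding smooth_on_def by blast
qed

lemma tendsto_nhds_velocity:
  "velocity X \<gamma> t \<Longrightarrow> (\<gamma> \<longlongrightarrow> \<gamma> t) (nhds t)"
  by (simp add: velocity_def isCont_def tendsto_at_iff_tendsto_nhds)

lemma velocity_unique_local:
  assumes X: "X \<in> lie_algebra G A"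
    and \<gamma>: "eventually (velocity X \<gamma>) (nhds t0)" and \<beta>: "eventually (velocity X \<beta>) (nhds t0)"
    and eq: "\<gamma> t0 = \<beta> t0"
  shows "eventually (\<lambda>t. \<gamma> t = \<beta> t) (nhds t0)"
proof -
  obtain c where c: "c \<in> A" "\<gamma> t0 \<in> fst c" by (rule chart_at)
  note C = is_chartD [OF c(1)]
  let ?z = "snd c (\<gamma> t0)" and ?F = "X c \<circ> coords_inv c"
  obtain r where r: "0 < r" "cball ?z r \<subseteq> snd c ` fst c"
    using C(2) c(2) by (auto simp: open_contains_cball)
  obtain L where L: "0 \<le> L"
    "\<forall>x\<in>cball ?z r. \<forall>y\<in>cball ?z r. norm (?F x - ?F y) \<le> L * norm (x - y)"
    using C1_Lipschitz_bound [OF lie_algebra_C1 [OF X c(1)] r(2)] by auto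
  let ?U = "fst c \<inter> snd c -` ball ?z r"
  have U: "open ?U" "\<gamma> t0 \<in> ?U" "\<beta> t0 \<in> ?U"
    using continuous_open_preimage [OF C(3,1)] c r eq by auto
  have "eventually (\<lambda>t. \<gamma> t \<in> ?U) (nhds t0)"
    using tendsto_nhds_velocity [OF eventually_nhds_x_imp_x [OF \<gamma>]] U
    by (intro topological_tendstoD)
  moreover have "eventually (\<lambda>t. \<beta> t \<in> ?U) (nhds t0)"
    using tendsto_nhds_velocity [OF eventually_nhds_x_imp_x [OF \<beta>]] U
    by (intro topological_tendstoD)
  ultimately have "eventually (\<lambda>t. \<gamma> t \<in> ?U \<and> \<beta> t \<in> ?U \<and> velocity X \<gamma> t \<and> velocity X \<beta> t) (nhds t0)"
    using \<gamma> \<beta> by eventually_elim blast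
  then obtain \<epsilon> where \<epsilon>: "\<epsilon> > 0"
    "\<And>t. dist t t0 < \<epsilon> \<Longrightarrow> \<gamma> t \<in> ?U \<and> \<beta> t \<in> ?U \<and> velocity X \<gamma> t \<and> velocity X \<beta> t"
    unfolding eventually_nhds_metric by blast
  \<comment> \<open>This is small enough for both curves to stay in the ball and for
    \<open>L * \<delta> < 1\<close>; the summand 1 covers \<open>L = 0\<close>.\<close>
  define \<delta> where "\<delta> = min (\<epsilon> / 2) (1 / (2 * (L + 1)))"
  have \<delta>: "0 < \<delta>" "\<delta> < \<epsilon>" using \<epsilon> L by (auto simp: \<delta>_def min_def)
  have "L * \<delta> \<le> L * (1 / (2 * (L + 1)))"
    using L by (intro mult_left_mono) (auto simp: \<delta>_def)
  also have "\<dots> < 1" using L by (simp add: field_simps)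
  finally have L\<delta>: "L * \<delta> < 1" .
  have sol: "(snd c \<circ> \<eta>) t \<in> cball ?z r \<and>
      ((snd c \<circ> \<eta>) has_vector_derivative ?F ((snd c \<circ> \<eta>) t)) (at t)"
    if "\<eta> t \<in> ?U" "velocity X \<eta> t" for \<eta> t
    using that c(1) C(6) [of "\<eta> t"] by (auto simp: velocity_def o_def)
  have both: "\<gamma> t \<in> ?U \<and> \<beta> t \<in> ?U \<and> velocity X \<gamma> t \<and> velocity X \<beta> t"
    if "t \<in> cball t0 \<delta>" for t
    by (rule \<epsilon>(2)) (use that \<delta> in \<open>auto simp: dist_commute\<close>)
  have "\<gamma> t = \<beta> t" if t: "dist t t0 < \<delta>" for t
  proof -
    have "(snd c \<circ> \<gamma>) t = (snd c \<circ> \<beta>) t"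
    proof (rule ode_unique_local [OF L(2) [rule_format] _ _ _ L\<delta> _ L(1)])
      show "(snd c \<circ> \<gamma>) t \<in> cball ?z r \<and> (snd c \<circ> \<gamma> has_vector_derivative ?F ((snd c \<circ> \<gamma>) t)) (at t)"
        "(snd c \<circ> \<beta>) t \<in> cball ?z r \<and> (snd c \<circ> \<beta> has_vector_derivative ?F ((snd c \<circ> \<beta>) t)) (at t)"
        if "t \<in> cball t0 \<delta>" for t
        using sol [of \<gamma> t] sol [of \<beta> t] both [OF that] by blast+
    qed (use eq \<delta> t in \<open>auto simp: dist_commute\<close>)
    moreover have "\<gamma> t \<in> fst c" "\<beta> t \<in> fst c" using \<epsilon>(2) [of t] t \<delta> by auto
    ultimately show ?thesis using C(6) by (metis comp_apply)
  qed
  then show ?thesis using \<delta> unfolding eventually_nhds_metric by blast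
qed

text \<open>The times of agreement form an open set by local uniqueness, and the times of
  disagreement form one because the curves are continuous in a Hausdorff space.\<close>

lemma velocity_unique:
  assumes X: "X \<in> lie_algebra G A" and I: "open I" "connected I"
    and \<gamma>: "\<And>t. t \<in> I \<Longrightarrow> velocity X \<gamma> t" and \<beta>: "\<And>t. t \<in> I \<Longrightarrow> velocity X \<beta> t"
    and t0: "t0 \<in> I" "\<gamma> t0 = \<beta> t0" and t: "t \<in> I"
  shows "\<gamma> t = \<beta> t"
proof -
  let ?S = "{t \<in> I. \<gamma> t = \<beta> t}" and ?T = "{t \<in> I. \<gamma> t \<noteq> \<beta> t}"
  have inI: "eventually (\<lambda>s. s \<in> I) (nhds t)" if "t \<in> I" for t
    using I(1) that by (rule eventually_nhds_in_open)
  have openI: "open S" if "\<And>t. t \<in> S \<Longrightarrow> eventually (\<lambda>s. s \<in> S) (nhds t)" for S :: "real set"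
  proof (subst open_subopen, intro ballI)
    fix t assume "t \<in> S"
    from that [OF this] show "\<exists>T. open T \<and> t \<in> T \<and> T \<subseteq> S"
      unfolding eventually_nhds by blast
  qed
  have "open ?S"
  proof (rule openI)
    fix t assume t: "t \<in> ?S"
    have "eventually (velocity X \<gamma>) (nhds t)" "eventually (velocity X \<beta>) (nhds t)"
      using inI [of t] t \<gamma> \<beta> by (auto elim!: eventually_mono)
    from velocity_unique_local [OF X this] have "eventually (\<lambda>s. \<gamma> s = \<beta> s) (nhds t)"
      using t by simp
    moreover have "eventually (\<lambda>s. s \<in> I) (nhds t)" using inI t by simp
    ultimately show "eventually (\<lambda>s. s \<in> ?S) (nhds t)" by eventually_elim simp
  qed
  moreover have "open ?T"
  proof (rule openI)
    fix t assume t: "t \<in> ?T"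
    then obtain U V where UV: "open U" "open V" "\<gamma> t \<in> U" "\<beta> t \<in> V" "U \<inter> V = {}"
      using hausdorff [of "\<gamma> t" "\<beta> t"] by auto
    have "eventually (\<lambda>s. \<gamma> s \<in> U) (nhds t)"
      using tendsto_nhds_velocity [OF \<gamma>] t UV by (intro topological_tendstoD) auto
    moreover have "eventually (\<lambda>s. \<beta> s \<in> V) (nhds t)"
      using tendsto_nhds_velocity [OF \<beta>] t UV by (intro topological_tendstoD) auto
    moreover have "eventually (\<lambda>s. s \<in> I) (nhds t)" using inI t by simp
    ultimately show "eventually (\<lambda>s. s \<in> ?T) (nhds t)"
      by eventually_elim (use UV(5) in auto)
  qed
  ultimately have "?S \<inter> I = {} \<or> ?T \<inter> I = {}"
    using I(2) by (intro connectedD) auto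
  then show ?thesis using t0 t by auto
qed

text \<open>The field depends linearly on \<open>w\<close>, so a small \<open>w\<close> makes the
  field small instead of the time short. Hence time 1 is inside the interval of existence, and the
  value there is continuous in \<open>w\<close>.\<close>

lemma local_flow:
  fixes \<iota> :: "'m::euclidean_space \<Rightarrow> ('g, 'e) vfield"
  assumes lin: "linear \<iota>" and \<iota>: "\<And>w. \<iota> w \<in> lie_algebra G A"
  obtains \<delta> \<phi> where "0 < \<delta>" "\<And>w. w \<in> cball 0 \<delta> \<Longrightarrow> \<phi> w 0 = \<one>"
    "\<And>w t. w \<in> cball 0 \<delta> \<Longrightarrow> t \<in> {-2<..<2} \<Longrightarrow> velocity (\<iota> w) (\<phi> w) t"
    "continuous_on (cball 0 \<delta>) (\<lambda>w. \<phi> w (1::real))"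
proof -
  obtain c where c: "c \<in> A" "\<one> \<in> fst c" by (rule chart_at)
  note C = is_chartD [OF c(1)]
  let ?x = "snd c \<one>"
  obtain r where r: "0 < r" "cball ?x r \<subseteq> snd c ` fst c"
    using C(2) c(2) by (auto simp: open_contains_cball)
  define F where "F w = \<iota> w c \<circ> coords_inv c" for w
  \<comment> \<open>Through this expansion, bounds for the fields of the basis vectors give bounds
    proportional to \<open>norm w\<close>.\<close>
  have F_sum: "F w x = (\<Sum>b\<in>Basis. (w \<bullet> b) *\<^sub>R F b x)" for w x
  proof -
    have sum: "sum f S c p = (\<Sum>b\<in>S. f b c p)" for S :: "'m set" and f :: "'m \<Rightarrow> ('g, 'e) vfield" and p
      by (induction S rule: infinite_finite_induct) auto
    have "\<iota> w = \<iota> (\<Sum>b\<in>Basis. (w \<bullet> b) *\<^sub>R b)" by (simp add: euclidean_representation)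
    also have "\<dots> = (\<Sum>b\<in>Basis. (w \<bullet> b) *\<^sub>R \<iota> b)"
      using lin by (simp add: linear_sum linear_scale)
    finally have "\<iota> w c p = (\<Sum>b\<in>Basis. (w \<bullet> b) *\<^sub>R \<iota> b c p)" for p
      by (simp add: sum scaleR_fun_def)
    then show ?thesis by (simp add: F_def)
  qed
  have "\<exists>L\<ge>0. (\<forall>x\<in>cball ?x r. norm (F b x) \<le> L) \<and>
    (\<forall>x\<in>cball ?x r. \<forall>y\<in>cball ?x r. norm (F b x - F b y) \<le> L * norm (x - y))" for b
    unfolding F_def by (rule C1_Lipschitz_bound [OF lie_algebra_C1 [OF \<iota> c(1)] r(2)])
  then have "\<exists>L. \<forall>b. 0 \<le> L b \<and> (\<forall>x\<in>cball ?x r. norm (F b x) \<le> L b) \<and>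
    (\<forall>x\<in>cball ?x r. \<forall>y\<in>cball ?x r. norm (F b x - F b y) \<le> L b * norm (x - y))"
    by (intro choice allI)
  then obtain L where all: "\<forall>b. 0 \<le> L b \<and> (\<forall>x\<in>cball ?x r. norm (F b x) \<le> L b) \<and>
    (\<forall>x\<in>cball ?x r. \<forall>y\<in>cball ?x r. norm (F b x - F b y) \<le> L b * norm (x - y))" ..
  have L: "0 \<le> L b" "x \<in> cball ?x r \<Longrightarrow> norm (F b x) \<le> L b"
    "x \<in> cball ?x r \<Longrightarrow> y \<in> cball ?x r \<Longrightarrow> norm (F b x - F b y) \<le> L b * norm (x - y)" for b x y
    using all by blast+
  define K where "K = (\<Sum>b\<in>Basis. L b)"
  have K: "0 \<le> K" using L(1) by (simp add: K_def sum_nonneg)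
  have F_bound: "norm (F w x) \<le> norm w * K" if "x \<in> cball ?x r" for w x
  proof -
    have "norm (F w x) \<le> (\<Sum>b\<in>Basis. norm w * L b)"
      unfolding F_sum [of w] using L(2) [OF that]
      by (intro sum_norm_le) (auto intro!: mult_mono simp: Basis_le_norm)
    then show ?thesis by (simp add: K_def sum_distrib_left)
  qed
  have F_lip: "norm (F w x - F w y) \<le> norm w * K * norm (x - y)"
    if "x \<in> cball ?x r" "y \<in> cball ?x r" for w x y
  proof -
    have "F w x - F w y = (\<Sum>b\<in>Basis. (w \<bullet> b) *\<^sub>R (F b x - F b y))"
      unfolding F_sum [of w] by (simp add: sum_subtractf scaleR_diff_right)
    also have "norm \<dots> \<le> (\<Sum>b\<in>Basis. norm w * (L b * norm (x - y)))"
      using L(3) [OF that] by (intro sum_norm_le) (auto intro!: mult_mono simp: Basis_le_norm)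
    finally show ?thesis by (simp add: K_def sum_distrib_left sum_distrib_right mult.assoc)
  qed
  \<comment> \<open>With this choice \<open>norm w * K\<close> is at most \<open>r / 2\<close> and
    at most \<open>1 / 4\<close>, the constants in \<open>picard\<close>.\<close>
  define \<delta> where "\<delta> = min (r / 2) (1 / 4) / (K + 1)"
  have \<delta>: "0 < \<delta>" using r K by (simp add: \<delta>_def)
  have wK: "norm w * K \<le> min (r / 2) (1 / 4)" if "w \<in> cball 0 \<delta>" for w :: 'm
  proof -
    have "norm w * K \<le> \<delta> * (K + 1)" using that K \<delta> by (intro mult_mono) auto
    also have "\<dots> = min (r / 2) (1 / 4)" using K by (simp add: \<delta>_def)
    finally show ?thesis .
  qed
  have F_cont: "continuous_on (cball ?x r) (F b)" for b
    by (rule lipschitz_on_continuous_on [of "L b"], rule lipschitz_onI)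
      (use L in \<open>auto simp: dist_norm\<close>)
  have "continuous_on (cball 0 \<delta> \<times> cball ?x r) (\<lambda>q. \<Sum>b\<in>Basis. (fst q \<bullet> b) *\<^sub>R F b (snd q))"
    by (intro continuous_on_sum continuous_on_scaleR continuous_on_compose2 [OF F_cont, of _ snd]
        continuous_intros) auto
  then have cont: "continuous_on (cball 0 \<delta> \<times> cball ?x r) (\<lambda>(w, x). F w x)"
    by (rule continuous_on_eq) (auto intro: F_sum [symmetric])
  have b: "norm (F w x) \<le> r / 2" if "w \<in> cball 0 \<delta>" "x \<in> cball ?x r" for w x
    using F_bound [OF that(2), of w] wK [OF that(1)] by simp
  have l: "norm (F w x - F w y) \<le> norm (x - y) / 4"
    if "w \<in> cball 0 \<delta>" "x \<in> cball ?x r" "y \<in> cball ?x r" for w x y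
  proof -
    have "norm w * K * norm (x - y) \<le> 1 / 4 * norm (x - y)"
      using wK [OF that(1)] by (intro mult_right_mono) auto
    then show ?thesis using F_lip [OF that(2,3), of w] by simp
  qed
  have "\<exists>y. continuous_on (cball 0 \<delta> \<times> {-2..2}) (\<lambda>(w, t). y w t) \<and>
    (\<forall>w\<in>cball 0 \<delta>. y w 0 = ?x \<and> (\<forall>t\<in>{-2..2::real}. y w t \<in> cball ?x r \<and>
      (y w has_vector_derivative F w (y w t)) (at t within {-2..2})))"
    using b l by (intro picard [OF less_imp_le [OF r(1)] cont])
  then obtain y where y_cont: "continuous_on (cball 0 \<delta> \<times> {-2..2}) (\<lambda>(w, t). y w t)"
    and y: "\<forall>w\<in>cball 0 \<delta>. y w 0 = ?x \<and> (\<forall>t\<in>{-2..2::real}. y w t \<in> cball ?x r \<and>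
      (y w has_vector_derivative F w (y w t)) (at t within {-2..2}))"
    by blast
  note y_0 = y [rule_format, THEN conjunct1]
    and y_in = y [rule_format, THEN conjunct2, rule_format, THEN conjunct1]
    and y_der = y [rule_format, THEN conjunct2, rule_format, THEN conjunct2]
  define \<phi> where "\<phi> w t = coords_inv c (y w t)" for w t
  have "\<phi> w 0 = \<one>" if "w \<in> cball 0 \<delta>" for w
    using y_0 [OF that] C(6) [OF c(2)] by (simp add: \<phi>_def)
  moreover have "velocity (\<iota> w) (\<phi> w) t" if w: "w \<in> cball 0 \<delta>" and t: "t \<in> {-2<..<2}" for w t
  proof (rule velocity_chart [OF \<iota> c(1)])
    have yC: "y w s \<in> snd c ` fst c" if "s \<in> {-2<..<2}" for s
      using y_in [OF w, of s] that r(2) by auto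
    have der: "(y w has_vector_derivative F w (y w t)) (at t)"
      using y_der [OF w, of t] t by (simp add: at_within_Icc_at)
    show "\<phi> w t \<in> fst c" unfolding \<phi>_def using yC [OF t] by (rule C(7))
    have "isCont (coords_inv c) (y w t)"
      using C(4) yC [OF t] unfolding continuous_on_eq_continuous_at [OF C(2)] by blast
    then show "isCont (\<phi> w) t"
      unfolding \<phi>_def by (rule isCont_o2 [OF has_vector_derivative_continuous [OF der]])
    have ev: "eventually (\<lambda>s. y w s = (snd c \<circ> \<phi> w) s) (nhds t)"
      using eventually_nhds_in_open [OF open_greaterThanLessThan t]
      by (rule eventually_mono) (simp add: \<phi>_def C(8) [OF yC])
    have "F w (y w t) = \<iota> w c (\<phi> w t)" by (simp add: F_def \<phi>_def)
    with der have "(y w has_vector_derivative \<iota> w c (\<phi> w t)) (at t)" by simp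
    from has_vector_derivative_cong_nhds [OF this ev]
    show "(snd c \<circ> \<phi> w has_vector_derivative \<iota> w c (\<phi> w t)) (at t)" .
  qed
  moreover have "continuous_on (cball 0 \<delta>) (\<lambda>w. \<phi> w 1)"
  proof -
    have "continuous_on (cball 0 \<delta>) (\<lambda>w. (\<lambda>(w, t). y w t) (w, 1))"
      by (rule continuous_on_compose2 [OF y_cont]) (auto intro!: continuous_intros)
    then have "continuous_on (cball 0 \<delta>) (\<lambda>w. y w 1)" by simp
    then show ?thesis
      unfolding \<phi>_def using y_in r(2) by (intro continuous_on_compose2 [OF C(4)]) auto
  qed
  ultimately show ?thesis using \<delta> by (intro that)
qed

text \<open>Left translates of an integral curve are integral curves, so translates by the powers of
  \<open>\<gamma> 1\<close> continue the curve to all times. Neighbouring pieces agree on their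
  overlap by uniqueness, which is \<open>step\<close>.\<close>

lemma extend_curve:
  assumes X: "X \<in> lie_algebra G A" and 0: "\<gamma> 0 = \<one>"
    and v: "\<And>t. t \<in> {-2<..<2} \<Longrightarrow> velocity X \<gamma> t"
  obtains \<Gamma> where "\<And>t. velocity X \<Gamma> t" "\<Gamma> 0 = \<one>" "\<Gamma> 1 = \<gamma> 1"
proof -
  have shift: "velocity X (\<lambda>s. a \<otimes> \<gamma> (s - b)) t" if "t - b \<in> {-2<..<2}" for a b t
    using velocity_translate [OF X, of "\<lambda>s. \<gamma> (s - b)" t a] velocity_affine [of X \<gamma> 1 t "- b"] v [OF that]
    by simp
  have step: "\<gamma> u = \<gamma> 1 \<otimes> \<gamma> (u - 1)" if "u \<in> {-1<..<2}" for u
  proof (rule velocity_unique [OF X, of "{-1<..<2}" \<gamma> "\<lambda>u. \<gamma> 1 \<otimes> \<gamma> (u - 1)" 1 u])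
    show "velocity X (\<lambda>u. \<gamma> 1 \<otimes> \<gamma> (u - 1)) t" if "t \<in> {-1<..<2}" for t
      using that by (intro shift) auto
  qed (use that v 0 in auto)
  define \<Gamma> where "\<Gamma> t = \<gamma> 1 [^] \<lfloor>t\<rfloor> \<otimes> \<gamma> (t - real_of_int \<lfloor>t\<rfloor>)" for t
  \<comment> \<open>The formula holds for remainders in \<open>(0, 2)\<close>, beyond those below 1
    that occur in the definition, so that every time is interior to the range of a single
    formula.\<close>
  have \<Gamma>: "\<Gamma> s = \<gamma> 1 [^] k \<otimes> \<gamma> (s - real_of_int k)" if "s - real_of_int k \<in> {0<..<2}" for s k
  proof (cases "s - real_of_int k < 1")
    case True
    then have "\<lfloor>s\<rfloor> = k" using that by (intro floor_unique) auto
    then show ?thesis by (simp add: \<Gamma>_def)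
  next
    case False
    then have fl: "\<lfloor>s\<rfloor> = k + 1" using that by (intro floor_unique) auto
    have "\<gamma> 1 [^] (k + 1) = \<gamma> 1 [^] k \<otimes> \<gamma> 1"
      using int_pow_mult [of "\<gamma> 1" k 1] by simp
    then show ?thesis
      using step [of "s - real_of_int k"] that by (simp add: \<Gamma>_def fl m_assoc diff_diff_eq)
  qed
  have "velocity X \<Gamma> t" for t
  proof (rule velocity_cong)
    \<comment> \<open>This puts \<open>t - real_of_int k\<close> in \<open>[1/2, 3/2)\<close>, well
      inside \<open>(0, 2)\<close>.\<close>
    define k where "k = \<lfloor>t - 1 / 2\<rfloor>"
    have k: "1 / 2 \<le> t - real_of_int k" "t - real_of_int k < 3 / 2" unfolding k_def by linarith+
    then show "velocity X (\<lambda>s. \<gamma> 1 [^] k \<otimes> \<gamma> (s - real_of_int k)) t"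
      by (intro shift) auto
    have "eventually (\<lambda>s. s \<in> {real_of_int k<..<real_of_int k + 2}) (nhds t)"
      using k by (intro eventually_nhds_in_open) auto
    then show "eventually (\<lambda>s. \<gamma> 1 [^] k \<otimes> \<gamma> (s - real_of_int k) = \<Gamma> s) (nhds t)"
      by (rule eventually_mono) (rule \<Gamma> [symmetric], auto)
  qed
  moreover have "\<Gamma> 0 = \<one>" "\<Gamma> 1 = \<gamma> 1"
    using 0 by (simp_all add: \<Gamma>_def int_pow_1)
  ultimately show ?thesis using that by blast
qed

end

section \<open>One-parameter subgroups and continuity of the exponential map\<close>

locale lie_exponential = chart_group G A
  for G :: "'g::{t2_space,second_countable_topology} monoid" (structure)
    and A :: "('g, 'e::euclidean_space) chart set" +
  fixes \<iota> :: "'m::euclidean_space \<Rightarrow> ('g, 'e) vfield"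
  assumes lin: "linear \<iota>" and \<iota>: "\<And>w. \<iota> w \<in> lie_algebra G A"
begin

lemma lexp_eq:
  assumes "\<And>t. velocity (\<iota> w) \<gamma> t" "\<gamma> 0 = \<one>"
  shows "lexp G A (\<iota> w) = \<gamma> 1"
proof -
  have "(THE \<gamma>. integral_curve A (\<iota> w) \<gamma> \<and> \<gamma> 0 = \<one>) = \<gamma>"
  proof (rule the_equality)
    show "integral_curve A (\<iota> w) \<gamma> \<and> \<gamma> 0 = \<one>"
      using assms by (simp add: integral_curve_iff)
    fix \<beta> assume "integral_curve A (\<iota> w) \<beta> \<and> \<beta> 0 = \<one>"
    then show "\<beta> = \<gamma>"
      using velocity_unique [OF \<iota> open_UNIV connected_UNIV, of w \<beta> \<gamma> 0] assms
      by (auto simp: integral_curve_iff)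
  qed
  then show ?thesis by (simp add: lexp_def)
qed

lemma scale_curve:
  assumes "\<And>t. velocity (\<iota> w) \<gamma> t"
  shows "velocity (\<iota> (r *\<^sub>R w)) (\<lambda>t. \<gamma> (r * t)) t"
  using velocity_affine [of "\<iota> w" \<gamma> r t 0] assms lin by (simp add: linear_scale)

lemma curve_exists:
  "\<exists>\<gamma>. \<forall>t. velocity (\<iota> w) \<gamma> t \<and> lexp G A (\<iota> (t *\<^sub>R w)) = \<gamma> t"
proof -
  obtain \<delta> \<phi> where \<delta>: "0 < \<delta>" and \<phi>: "\<And>w. w \<in> cball 0 \<delta> \<Longrightarrow> \<phi> w 0 = \<one>"
    "\<And>w t. w \<in> cball 0 \<delta> \<Longrightarrow> t \<in> {-2<..<2} \<Longrightarrow> velocity (\<iota> w) (\<phi> w) t"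
    using local_flow [OF lin \<iota>] by metis
  \<comment> \<open>This shrinks \<open>w\<close> into the ball of the local flow; the summand 1
    covers \<open>w = 0\<close>. The curve of \<open>w\<close> itself is recovered by the time
    change \<open>t / r\<close>.\<close>
  define r where "r = \<delta> / (norm w + 1)"
  have r: "0 < r" using \<delta> by (simp add: r_def add_nonneg_pos)
  have "norm (r *\<^sub>R w) \<le> r * (norm w + 1)" using r by simp
  also have "\<dots> = \<delta>" by (simp add: r_def add_nonneg_eq_0_iff)
  finally have "r *\<^sub>R w \<in> cball 0 \<delta>" by simp
  then obtain \<Gamma> where \<Gamma>: "\<And>t. velocity (\<iota> (r *\<^sub>R w)) \<Gamma> t" "\<Gamma> 0 = \<one>"
    using extend_curve [OF \<iota>, of "\<phi> (r *\<^sub>R w)" "r *\<^sub>R w"] \<phi> by metis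
  have v: "velocity (\<iota> w) (\<lambda>t. \<Gamma> (t / r)) t" for t
    using scale_curve [OF \<Gamma>(1), of "1 / r" t] r by simp
  moreover have "lexp G A (\<iota> (t *\<^sub>R w)) = \<Gamma> (t / r)" for t
    using lexp_eq [of "t *\<^sub>R w" "\<lambda>s. \<Gamma> (t * s / r)"] scale_curve [OF v, of t] \<Gamma>(2) by simp
  ultimately show ?thesis by blast
qed

text \<open>The shifted curve and the translated curve are integral curves of the same field with
  the same value at 0.\<close>

lemma lexp_add: "lexp G A (\<iota> ((a + b) *\<^sub>R w)) = lexp G A (\<iota> (a *\<^sub>R w)) \<otimes> lexp G A (\<iota> (b *\<^sub>R w))"
proof -
  obtain \<gamma> where \<gamma>: "\<And>t. velocity (\<iota> w) \<gamma> t" "\<And>t. lexp G A (\<iota> (t *\<^sub>R w)) = \<gamma> t"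
    using curve_exists [of w] by blast
  have "\<gamma> 0 = \<one>"
  proof -
    \<comment> \<open>Scaling time by 0 gives the constant curve \<open>\<gamma> 0\<close>, and a
      left translation moves it to \<open>\<one>\<close>.\<close>
    have "\<And>t. velocity (\<iota> 0) (\<lambda>_. \<one>) t"
      using scale_curve [OF \<gamma>(1), of 0] velocity_translate [OF \<iota>, of 0 _ _ "inv (\<gamma> 0)"] by force
    then have "lexp G A (\<iota> 0) = \<one>" by (rule lexp_eq) simp
    then show ?thesis using \<gamma>(2) [of 0] by simp
  qed
  have "\<gamma> (1 * b + a) = \<gamma> a \<otimes> \<gamma> b"
  proof (rule velocity_unique [OF \<iota> open_UNIV connected_UNIV, of w "\<lambda>t. \<gamma> (1 * t + a)" "\<lambda>t. \<gamma> a \<otimes> \<gamma> t" 0 b])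
    show "velocity (\<iota> w) (\<lambda>t. \<gamma> (1 * t + a)) t" for t
      using velocity_affine [of "\<iota> w" \<gamma> 1 t a] \<gamma>(1) by simp
    show "velocity (\<iota> w) (\<lambda>t. \<gamma> a \<otimes> \<gamma> t) t" for t
      using \<gamma>(1) by (intro velocity_translate \<iota>)
  qed (use \<open>\<gamma> 0 = \<one>\<close> in auto)
  then show ?thesis by (simp add: \<gamma>(2) add.commute)
qed

text \<open>The local flow gives continuity near 0. Elsewhere the exponential of \<open>w\<close> is
  the \<open>n\<close>-th power of that of \<open>w / n\<close>, and \<open>w / n\<close> is near 0
  for large \<open>n\<close>.\<close>

lemma continuous_lexp: "continuous_on UNIV (\<lambda>w. lexp G A (\<iota> w))"
proof -
  let ?e = "\<lambda>w. lexp G A (\<iota> w)"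
  obtain \<delta> \<phi> where \<delta>: "0 < \<delta>" and \<phi>: "\<And>w. w \<in> cball 0 \<delta> \<Longrightarrow> \<phi> w 0 = \<one>"
    "\<And>w t. w \<in> cball 0 \<delta> \<Longrightarrow> t \<in> {-2<..<2} \<Longrightarrow> velocity (\<iota> w) (\<phi> w) t"
    and cont: "continuous_on (cball 0 \<delta>) (\<lambda>w. \<phi> w (1::real))"
    using local_flow [OF lin \<iota>] by metis
  have eq: "?e w = \<phi> w 1" if w: "w \<in> cball 0 \<delta>" for w
  proof -
    obtain \<Gamma> where "\<And>t. velocity (\<iota> w) \<Gamma> t" "\<Gamma> 0 = \<one>" "\<Gamma> 1 = \<phi> w 1"
      using extend_curve [OF \<iota>, of "\<phi> w" w] \<phi> w by metis
    then show ?thesis using lexp_eq by metis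
  qed
  have "continuous_on (cball 0 \<delta>) ?e"
    by (rule continuous_on_eq [OF cont eq [symmetric]])
  then have small: "isCont ?e v" if "v \<in> ball 0 \<delta>" for v
    using that continuous_on_subset [OF _ ball_subset_cball]
    by (metis continuous_on_eq_continuous_at open_ball)
  have pow: "isCont (\<lambda>v. ?e (real n *\<^sub>R v)) v" if v: "v \<in> ball 0 \<delta>" for n v
  proof (induction n)
    case 0
    then show ?case by simp
  next
    case (Suc n)
    have "?e (real (Suc n) *\<^sub>R v) = ?e (real n *\<^sub>R v) \<otimes> ?e v" for v
      using lexp_add [of "real n" 1 v] by (simp add: add.commute)
    then show ?case
      using tendsto_mult [OF Suc.IH [unfolded isCont_def] small [OF v, unfolded isCont_def]]
      by (simp add: isCont_def)
  qed
  have "isCont ?e w" for w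
  proof -
    obtain n where n: "norm w / \<delta> < real n" using reals_Archimedean2 by blast
    then have n0: "0 < real n" using \<delta> by (meson divide_nonneg_pos le_less_trans norm_ge_zero)
    have "(1 / real n) *\<^sub>R w \<in> ball 0 \<delta>"
      using n n0 \<delta> by (simp add: field_simps)
    from pow [OF this, of n] have "isCont (\<lambda>v. ?e (real n *\<^sub>R v)) ((1 / real n) *\<^sub>R w)" .
    then have "isCont (\<lambda>w. ?e (real n *\<^sub>R ((1 / real n) *\<^sub>R w))) w"
      by (rule isCont_o2 [rotated]) (intro continuous_intros)
    then show ?thesis using n0 by simp
  qed
  then show ?thesis by (simp add: continuous_on_eq_continuous_at)
qed

end

section \<open>Monotone sets in Carnot groups\<close>

context one_parameter begin

lemma connected_line:
  assumes "\<And>y a b. 0 < a \<Longrightarrow> a < b \<Longrightarrow> y \<in> F \<Longrightarrow> y \<otimes> e (b *\<^sub>R w) \<in> F \<Longrightarrow> y \<otimes> e (a *\<^sub>R w) \<in> F"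
  shows "connected (F \<inter> range (\<lambda>t. x \<otimes> e (t *\<^sub>R w)))"
proof -
  let ?l = "\<lambda>t. x \<otimes> e (t *\<^sub>R w)"
  have "is_interval {t. ?l t \<in> F}"
    unfolding is_interval_1
  proof (intro ballI allI impI)
    fix r t s assume r: "r \<in> {t. ?l t \<in> F}" and t: "t \<in> {t. ?l t \<in> F}" and s: "r \<le> s \<and> s \<le> t"
    show "s \<in> {t. ?l t \<in> F}"
    proof (cases "s = r \<or> s = t")
      case False
      have shift: "?l r \<otimes> e ((q - r) *\<^sub>R w) = ?l q" for q
        unfolding mult_e_mult_e by simp
      show ?thesis
        using assms [of "s - r" "t - r" "?l r"] False r t s unfolding shift by simp
    qed (use r t in auto)
  qed
  moreover have "continuous_on UNIV ?l"
    by (intro continuous_on_mult continuous_on_const continuous_on_compose2 [OF continuous_e]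
        continuous_intros) auto
  ultimately have "connected (?l ` {t. ?l t \<in> F})"
    by (intro connected_continuous_image) (auto intro: continuous_on_subset simp: is_interval_connected)
  moreover have "?l ` {t. ?l t \<in> F} = F \<inter> range ?l" by auto
  ultimately show ?thesis by simp
qed

lemma e_prod_const: "e_prod p (\<lambda>_. w) = e (real p *\<^sub>R w)"
proof (induction p)
  case (Suc p)
  have "e_prod (Suc p) (\<lambda>_. w) = e (real p *\<^sub>R w) \<otimes> e (1 *\<^sub>R w)"
    by (simp only: e_prod.simps Suc scaleR_one)
  also have "\<dots> = e ((real p + 1) *\<^sub>R w)"
    by (rule e_add [symmetric])
  finally show ?case by (simp only: of_nat_Suc add.commute)
qed simp

lemma no_return_zero: "no_return E 0"
  by (simp add: no_return_def)

text \<open>Applied to \<open>E\<close> and to \<open>- E\<close>, the two claims cover the four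
  sets in the precise monotonicity of interior and support.\<close>

lemma connected_lines:
  assumes E: "E \<in> sets borel" and nr: "\<And>v. no_return E v" "\<And>v. no_return (- E) v"
    and p: "open_at p (- w)"
  shows "connected (ae_interior E \<inter> range (\<lambda>t. x \<otimes> e (t *\<^sub>R w)))"
    and "connected (- ae_interior (- E) \<inter> range (\<lambda>t. x \<otimes> e (t *\<^sub>R w)))"
proof -
  show "connected (ae_interior E \<inter> range (\<lambda>t. x \<otimes> e (t *\<^sub>R w)))"
    by (rule connected_line) (rule ae_interior_between [OF nr(1)])
  show "connected (- ae_interior (- E) \<inter> range (\<lambda>t. x \<otimes> e (t *\<^sub>R w)))"
    by (rule connected_line) (unfold Compl_iff, rule not_ae_interior_between [OF E nr p])
qed

end

section \<open>Application to Carnot groups\<close>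

lemma borel_slice:
  fixes B :: "('m::euclidean_space \<times> 'g::{t2_space,second_countable_topology}) set"
  assumes "B \<in> sets (restrict_space borel (SIGMA v:S. N v))" "v \<in> S"
  shows "{x. (v, x) \<in> B} \<in> sets (restrict_space borel (N v))"
proof -
  obtain C :: "('m \<times> 'g) set" where C: "C \<in> sets borel" "B = (SIGMA v:S. N v) \<inter> C"
    using assms(1) by (auto simp: sets_restrict_space)
  have "Pair v \<in> borel_measurable (borel :: 'g measure)"
    by (intro borel_measurable_continuous_onI continuous_intros)
  then have "Pair v -` C \<in> sets borel"
    using measurable_sets [of "Pair v" borel borel C] C by simp
  moreover have "{x. (v, x) \<in> B} = N v \<inter> Pair v -` C"
    using assms(2) C by auto
  ultimately show ?thesis by (auto simp: sets_restrict_space)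
qed

theorem theorem1p5:
  fixes G :: "'g::{t2_space,second_countable_topology} monoid"
    and A :: "('g, 'e::euclidean_space) chart set"
    and V :: "nat \<Rightarrow> ('g, 'e) vfield set" and s :: nat
    and \<iota> :: "'m::euclidean_space \<Rightarrow> ('g, 'e) vfield"
    and \<mu> :: "'g measure" and E :: "'g set"
  assumes "carnot_group G A V s"
    and "layer_coords V \<iota>"
    and "haar_measure G UNIV \<mu>"
    and "\<forall>X\<in>V 1 - {0}. \<exists>p\<ge>2. open_map_at
           (product_topology (\<lambda>_. layer_topology \<iota>) {..<p}) euclidean
           (Gamma_prod G A p) (\<lambda>i\<in>{..<p}. X)"
    and "monotone_set G A V s \<iota> \<mu> E"
  shows "precisely_monotone G A V (Int_meas \<mu> E) \<and> precisely_monotone G A V (spt_meas \<mu> E)"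
proof -
  have lie: "lie_group G A" and V1: "V 1 \<subseteq> lie_algebra G A"
    using assms(1) by (simp_all add: carnot_group_def stratification_def)
  have lin: "linear \<iota>" and bij: "bij_betw \<iota> UNIV (V 1)"
    using assms(2) by (simp_all add: layer_coords_def)
  have range: "range \<iota> = V 1" and inj: "inj \<iota>"
    using bij by (simp_all add: bij_betw_def)
  define e where "e w = lexp G A (\<iota> w)" for w
  interpret L: lie_exponential G A \<iota>
    unfolding lie_exponential_def lie_exponential_axioms_def chart_group_def
    using lie lin V1 range by blast
  interpret one_parameter G \<mu> e
    using L.locally_compact_chart assms(3) L.continuous_lexp L.lexp_add
    by unfold_locales (simp_all add: e_def)
  have e_scale: "lexp G A (t *\<^sub>R \<iota> w) = e (t *\<^sub>R w)" for t w
    using lin by (simp add: e_def linear_scale)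
  have open_at: "\<exists>p. open_at p w" if w: "w \<noteq> 0" for w
  proof -
    have "\<iota> w \<noteq> 0" using injD [OF inj, of w 0] linear_0 [OF lin] w by auto
    moreover have "\<iota> w \<in> V 1" using range by blast
    ultimately have "\<iota> w \<in> V 1 - {0}" by blast
    then obtain p where p: "open_map_at (product_topology (\<lambda>_. layer_topology \<iota>) {..<p}) euclidean
        (Gamma_prod G A p) (\<lambda>i\<in>{..<p}. \<iota> w)"
      using assms(4) by blast
    \<comment> \<open>Only entries below \<open>q\<close> are compared, because restricted families
      such as \<open>\<lambda>i\<in>{..<p}. \<iota> w\<close> are \<open>undefined\<close>
      elsewhere.\<close>
    have Gamma: "Gamma_prod G A q Y = e_prod q Z" if "\<forall>i<q. Y i = \<iota> (Z i)" for q Y Z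
      using that by (induction q) (simp_all add: e_def)
    have "open_at p w"
      unfolding open_at_def
    proof (intro allI impI)
      fix D assume D: "open D \<and> w \<in> D"
      let ?N = "PiE {..<p} (\<lambda>_. \<iota> ` D)"
      have "inv_into UNIV \<iota> -` D \<inter> range \<iota> = \<iota> ` D"
        using inj by (auto simp: inv_f_f)
      then have "openin (layer_topology \<iota>) (\<iota> ` D)"
        using D unfolding layer_topology_def openin_pullback_topology by (metis open_openin)
      then have "openin (product_topology (\<lambda>_. layer_topology \<iota>) {..<p}) ?N"
        by (simp add: openin_PiE_gen)
      moreover have "(\<lambda>i\<in>{..<p}. \<iota> w) \<in> ?N" using D by auto
      ultimately have "nbhd_of (product_topology (\<lambda>_. layer_topology \<iota>) {..<p}) (\<lambda>i\<in>{..<p}. \<iota> w) ?N"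
        unfolding nbhd_of_def using openin_subset by blast
      then have "nbhd_of euclidean (Gamma_prod G A p (\<lambda>i\<in>{..<p}. \<iota> w)) (Gamma_prod G A p ` ?N)"
        using p unfolding open_map_at_def by blast
      then obtain T where T: "open T" "Gamma_prod G A p (\<lambda>i\<in>{..<p}. \<iota> w) \<in> T" "T \<subseteq> Gamma_prod G A p ` ?N"
        unfolding nbhd_of_def by auto
      have "Gamma_prod G A p (\<lambda>i\<in>{..<p}. \<iota> w) = e (real p *\<^sub>R w)"
        using Gamma [of p "\<lambda>i\<in>{..<p}. \<iota> w" "\<lambda>_. w"] e_prod_const by simp
      moreover have "Gamma_prod G A p ` ?N \<subseteq> e_prod p ` {Y. \<forall>i<p. Y i \<in> D}"
      proof
        fix g assume "g \<in> Gamma_prod G A p ` ?N"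
        then obtain Y where Y: "Y \<in> ?N" "g = Gamma_prod G A p Y" by blast
        have "\<forall>i<p. Y i \<in> \<iota> ` D" using Y by auto
        then have "\<forall>i<p. inv_into UNIV \<iota> (Y i) \<in> D \<and> Y i = \<iota> (inv_into UNIV \<iota> (Y i))"
          using inj by (auto simp: inv_f_f)
        then show "g \<in> e_prod p ` {Y. \<forall>i<p. Y i \<in> D}"
          using Y(2) Gamma [of p Y "\<lambda>i. inv_into UNIV \<iota> (Y i)"] by blast
      qed
      ultimately show "\<exists>T. open T \<and> e (real p *\<^sub>R w) \<in> T \<and> T \<subseteq> e_prod p ` {Y. \<forall>i<p. Y i \<in> D}"
        using T by (intro exI [of _ T]) auto
    qed
    then show ?thesis ..
  qed
  have mE: "E \<in> sets (completion \<mu>)"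
    using assms(5) by (simp add: monotone_set_def)
  \<comment> \<open>The limit arguments need a Borel set; \<open>E'\<close> differs from
    \<open>E\<close> by a null set, which changes neither interior nor support.\<close>
  obtain E' N N' where E': "E = E' \<union> N" "N \<subseteq> N'" "N' \<in> null_sets \<mu>" "E' \<in> sets \<mu>"
    using mE by (rule sets_completionE)
  then have bE': "E' \<in> sets borel" by simp
  have "AE u in \<mu>. u \<notin> N'" using E'(3) by (rule AE_not_in)
  then have EE': "AE u in \<mu>. u \<in> E \<longleftrightarrow> u \<in> E'"
    by (rule eventually_mono) (use E' in auto)
  obtain \<nu> B where \<nu>: "\<forall>v\<in>sphere 0 1. slice_measure G A V s \<iota> \<mu> v (\<nu> v)"
    and B: "B \<in> sets (restrict_space borel (line_bundle G A V s \<iota>))"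
      "{(v, x) \<in> line_bundle G A V s \<iota>. \<not> line_monotone G A E x (\<iota> v)} \<subseteq> B"
      "(\<lambda>v. emeasure (\<nu> v) {x. (v, x) \<in> B}) \<in> borel_measurable sphere_measure"
      "(\<integral>\<^sup>+v. emeasure (\<nu> v) {x. (v, x) \<in> B} \<partial>sphere_measure) = 0"
    using assms(5) unfolding monotone_set_def null_lines_def by blast
  \<comment> \<open>The part of the exceptional set \<open>B\<close> in the direction of
    \<open>y\<close> is null, so almost every line in this direction is monotone for
    \<open>E\<close>. The result for the unit vector is then rescaled to \<open>y\<close>.\<close>
  have good: "no_return E' y \<and> no_return (- E') y"
    if y: "y \<noteq> 0" "emeasure (\<nu> (sgn y)) {x. (sgn y, x) \<in> B} = 0" for y
  proof -
    let ?v = "sgn y"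
    have v: "?v \<in> sphere 0 1" using y by (simp add: norm_sgn)
    have sm: "slice_measure G A V s \<iota> \<mu> ?v (\<nu> ?v)" using \<nu> v by blast
    have sets: "sets (\<nu> ?v) = sets (restrict_space borel (slice G A V s \<iota> ?v))"
      using sm by (simp add: slice_measure_def haar_measure_def)
    then have sp: "space (\<nu> ?v) = slice G A V s \<iota> ?v"
      using sets_eq_imp_space_eq [OF sets] by (simp add: space_restrict_space)
    have "{x. (?v, x) \<in> B} \<in> sets (\<nu> ?v)"
      unfolding sets using B(1) v unfolding line_bundle_def by (rule borel_slice)
    then have "AE x in \<nu> ?v. x \<notin> {x. (?v, x) \<in> B}"
      using y(2) by (intro AE_not_in) (simp add: null_sets_def)
    then have "AE x in \<nu> ?v. line_monotone G A E x (\<iota> ?v)"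
    proof (rule AE_mp, intro AE_I2 impI)
      fix x assume x: "x \<in> space (\<nu> ?v)" "x \<notin> {x. (?v, x) \<in> B}"
      then have "(?v, x) \<in> line_bundle G A V s \<iota>"
        using v sp by (simp add: line_bundle_def)
      with x(2) B(2) show "line_monotone G A E x (\<iota> ?v)" by blast
    qed
    then have mon: "AE x in \<nu> ?v. \<exists>h :: real \<Rightarrow> real. (mono h \<or> antimono h) \<and>
        (AE t in lborel. indicator E (x \<otimes>\<^bsub>G\<^esub> e (t *\<^sub>R ?v)) = h t)"
      by (simp add: line_monotone_def e_scale)
    have f: "(\<lambda>(x, t). x \<otimes>\<^bsub>G\<^esub> e (t *\<^sub>R ?v)) \<in> measurable (\<nu> ?v \<Otimes>\<^sub>M lborel) \<mu>"
      "distr (\<nu> ?v \<Otimes>\<^sub>M lborel) \<mu> (\<lambda>(x, t). x \<otimes>\<^bsub>G\<^esub> e (t *\<^sub>R ?v)) = \<mu>"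
      using sm by (simp_all add: slice_measure_def e_scale)
    have "no_return E' (norm y *\<^sub>R ?v)" "no_return (- E') (norm y *\<^sub>R ?v)"
      using no_return_slice [OF bE' EE' f mon] y(1) by (auto intro!: no_return_scale)
    moreover have "norm y *\<^sub>R ?v = y" using y(1) by (simp add: sgn_div_norm)
    ultimately show ?thesis by simp
  qed
  \<comment> \<open>The good vectors are dense because the integral over the sphere vanishes, and
    \<open>no_return\<close> passes to limits. For the vector 0 the three points of the pattern
    coincide.\<close>
  have nr: "no_return E' w" "no_return (- E') w" for w
  proof -
    have "no_return E' w \<and> no_return (- E') w"
    proof (cases "w = 0")
      case False
      let ?D = "{y. y \<noteq> 0 \<and> emeasure (\<nu> (sgn y)) {x. (sgn y, x) \<in> B} = 0}"
      have w: "w \<in> closure ?D" by (rule dense_if_AE_sphere [OF B(3,4) False])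
      have "?D \<subseteq> {y. no_return E' y}" "?D \<subseteq> {y. no_return (- E') y}" using good by auto
      then have "w \<in> closure {y. no_return E' y}" "w \<in> closure {y. no_return (- E') y}"
        using closure_mono w by blast+
      then show ?thesis
        using bE' by (intro conjI no_return_closed) auto
    qed (simp add: no_return_zero)
    then show "no_return E' w" "no_return (- E') w" by auto
  qed
  have cE': "- E' \<in> sets borel" using bE' by simp
  have nr': "no_return (- (- E')) w" for w using nr(1) by simp
  have compl: "AE u in \<mu>. u \<in> - E \<longleftrightarrow> u \<in> - E'" using EE' by (rule eventually_mono) simp
  have Int: "Int_meas \<mu> E = ae_interior E'"
    using Int_meas_eq [OF mE] ae_interior_cong [OF EE'] by simp
  have spt: "spt_meas \<mu> E = - ae_interior (- E')"
    using spt_meas_eq [OF mE] ae_interior_cong [OF compl] by simp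
  have lines: "connected (ae_interior E' \<inter> line_set G A x X)"
    "connected (line_set G A x X - ae_interior E')"
    "connected (- ae_interior (- E') \<inter> line_set G A x X)"
    "connected (line_set G A x X - - ae_interior (- E'))"
    if X: "X \<in> V 1 - {0}" for x X
  proof -
    obtain w where w: "X = \<iota> w" using X range by blast
    then have "- w \<noteq> 0" using X linear_0 [OF lin] by auto
    then obtain p where p: "open_at p (- w)" using open_at by blast
    have line: "line_set G A x X = range (\<lambda>t. x \<otimes>\<^bsub>G\<^esub> e (t *\<^sub>R w))"
      by (simp add: line_set_def w e_scale)
    \<comment> \<open>The complement of \<open>ae_interior E'\<close> plays for \<open>- E'\<close>
      the role of the support, and \<open>ae_interior (- E')\<close> that of the interior, so the
      application to \<open>- E'\<close> gives the two differences.\<close>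
    note 1 = connected_lines [OF bE' nr p, of x] and 2 = connected_lines [OF cE' nr(2) nr' p, of x]
    show "connected (ae_interior E' \<inter> line_set G A x X)"
      "connected (- ae_interior (- E') \<inter> line_set G A x X)"
      unfolding line by (rule 1)+
    show "connected (line_set G A x X - ae_interior E')"
      "connected (line_set G A x X - - ae_interior (- E'))"
      using 2 unfolding line by (simp_all add: Diff_eq Int_commute)
  qed
  then show ?thesis
    unfolding precisely_monotone_def Int spt by blast
qed

end
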